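(* Let $p>0$, let $\Omega\subset\mathbb{R}^n$ ($n\ge 1$) be a smooth bounded domain, and let $M,r>0$. There exists $\gamma_0>0$, depending only on $p,\Omega,M,r$, such that the following holds. Let $f\in E$ satisfy $$T_f\le M,\qquad \|f\|_\infty\le M,\qquad f\ge r\chi_B \ \text{ for some ball } B\subset\Omega \text{ of radius } r.$$ Then for any $x_0\in\Omega$, if $$f(x_0)<\gamma_0\,\delta^{p+1}(x_0),$$ then $x_0\notin\mathcal{T}_f$.
   Context: $E$ is the set of Hölder continuous functions $f:\overline\Omega\to[0,\infty)$. For $f\in E$, $u$ denotes the unique maximal classical solution of $$u_t-\Delta u=f(x)(1-u)^{-p}\ (t>0,\ x\in\Omega),\qquad u=0\ (t>0,\ x\in\partial\Omega),\qquad u(0,x)=0\ (x\in\Omega),$$ and $T=T_f\in(0,\infty]$ denotes its maximal existence time. A point $x_0\in\overline\Omega$ is a touchdown point if there is a sequence $(t_i,x_i)\in(0,T)\times\Omega$ with $x_i\to x_0$, $t_i\uparrow T$ and $u(t_i,x_i)\to 1$. The set of all touchdown points is the touchdown set $\mathcal{T}_f\subset\overline\Omega$. Also $\delta(x)=\mathrm{dist}(x,\partial\Omega)$, $\chi_B$ is the indicator function of $B$, and $\|\cdot\|_\infty$ is the norm of $L^\infty(\Omega)$. *)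

theory Defs
  imports "HOL-Analysis.Analysis" "HOL-Probability.Essential_Supremum"
begin

text \<open>The space $\mathbb{R}^n$, $n \ge 1$, is rendered by a type of class \<open>euclidean_space\<close>,
  with the coordinate directions given by \<open>Basis\<close>.\<close>

section \<open>Differentiability classes and smooth bounded domains\<close>

definition partial :: "'a::euclidean_space \<Rightarrow> ('a \<Rightarrow> real) \<Rightarrow> 'a \<Rightarrow> real" where
  "partial b g x = frechet_derivative g (at x) b"

definition laplacian :: "('a::euclidean_space \<Rightarrow> real) \<Rightarrow> 'a \<Rightarrow> real" where
  "laplacian g x = (\<Sum>b\<in>Basis. partial b (partial b g) x)"

text \<open>Only meaningful for open \<open>S\<close>.\<close>

primrec Ck_on :: "nat \<Rightarrow> 'a::euclidean_space set \<Rightarrow> ('a \<Rightarrow> real) \<Rightarrow> bool" where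
  "Ck_on 0 S g \<longleftrightarrow> continuous_on S g"
| "Ck_on (Suc k) S g \<longleftrightarrow>
     (\<forall>x\<in>S. g differentiable (at x)) \<and> (\<forall>b\<in>Basis. Ck_on k S (partial b g))"

text \<open>The boundary is \<open>C\<^sup>\<infinity>\<close>: near each boundary point, in suitably rotated coordinates with last
  axis \<open>v\<close>, the domain is the region above the graph of a smooth function of the remaining
  coordinates. The argument of \<open>h\<close> is the orthogonal projection of \<open>x\<close> onto the
  hyperplane orthogonal to \<open>v\<close>; values of \<open>h\<close> off that hyperplane play no role.\<close>

definition smooth_boundary :: "'a::euclidean_space set \<Rightarrow> bool" where
  "smooth_boundary \<Omega> \<longleftrightarrow>
     (\<forall>y\<in>frontier \<Omega>. \<exists>\<rho>>0. \<exists>v. \<exists>h. norm v = 1 \<and> (\<forall>k. Ck_on k UNIV h) \<and>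
        \<Omega> \<inter> ball y \<rho> = {x \<in> ball y \<rho>. h (x - (x \<bullet> v) *\<^sub>R v) < x \<bullet> v})"

definition smooth_bounded_domain :: "'a::euclidean_space set \<Rightarrow> bool" where
  "smooth_bounded_domain \<Omega> \<longleftrightarrow>
     open \<Omega> \<and> connected \<Omega> \<and> \<Omega> \<noteq> {} \<and> bounded \<Omega> \<and> smooth_boundary \<Omega>"

section \<open>The data\<close>

text \<open>The class \<open>E\<close>; functions are total, but their values outside \<open>closure \<Omega>\<close> are irrelevant.\<close>

definition holder_profiles :: "'a::euclidean_space set \<Rightarrow> ('a \<Rightarrow> real) set" where
  "holder_profiles \<Omega> =
     {f. (\<forall>x\<in>closure \<Omega>. 0 \<le> f x) \<and>
         (\<exists>\<alpha> C. 0 < \<alpha> \<and> \<alpha> \<le> 1 \<and>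
            (\<forall>x\<in>closure \<Omega>. \<forall>y\<in>closure \<Omega>. \<bar>f x - f y\<bar> \<le> C * dist x y powr \<alpha>))}"

definition Linf_norm :: "'a::euclidean_space set \<Rightarrow> ('a \<Rightarrow> real) \<Rightarrow> ereal" where
  "Linf_norm \<Omega> f = esssup (lebesgue_on \<Omega>) (\<lambda>x. ereal \<bar>f x\<bar>)"

section \<open>Classical solutions and touchdown\<close>

definition C21_on :: "ereal \<Rightarrow> 'a::euclidean_space set \<Rightarrow> (real \<Rightarrow> 'a \<Rightarrow> real) \<Rightarrow> bool" where
  "C21_on T \<Omega> u \<longleftrightarrow>
     (let Q = {t. 0 < t \<and> ereal t < T} \<times> \<Omega> in
       (\<forall>(t, x)\<in>Q. (\<lambda>s. u s x) differentiable (at t)) \<and>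
       (\<forall>t. 0 < t \<and> ereal t < T \<longrightarrow> Ck_on 2 \<Omega> (u t)) \<and>
       continuous_on Q (\<lambda>(t, x). deriv (\<lambda>s. u s x) t) \<and>
       (\<forall>b\<in>Basis. continuous_on Q (\<lambda>(t, x). partial b (u t) x)) \<and>
       (\<forall>b\<in>Basis. \<forall>c\<in>Basis. continuous_on Q (\<lambda>(t, x). partial c (partial b (u t)) x)))"

text \<open>The condition \<open>u < 1\<close> is implicit in \<open>(1 - u)\<^sup>-\<^sup>p\<close>; it has to be explicit here because
  \<open>powr\<close> is total.\<close>

definition classical_solution ::
  "real \<Rightarrow> 'a::euclidean_space set \<Rightarrow> ('a \<Rightarrow> real) \<Rightarrow> ereal \<Rightarrow> (real \<Rightarrow> 'a \<Rightarrow> real) \<Rightarrow> bool" where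
  "classical_solution p \<Omega> f T u \<longleftrightarrow>
     0 < T \<and>
     continuous_on ({t. 0 \<le> t \<and> ereal t < T} \<times> closure \<Omega>) (\<lambda>(t, x). u t x) \<and>
     C21_on T \<Omega> u \<and>
     (\<forall>t x. 0 \<le> t \<and> ereal t < T \<and> x \<in> closure \<Omega> \<longrightarrow> u t x < 1) \<and>
     (\<forall>t x. 0 < t \<and> ereal t < T \<and> x \<in> \<Omega> \<longrightarrow>
        deriv (\<lambda>s. u s x) t - laplacian (u t) x = f x * (1 - u t x) powr (- p)) \<and>
     (\<forall>t x. 0 < t \<and> ereal t < T \<and> x \<in> frontier \<Omega> \<longrightarrow> u t x = 0) \<and>
     (\<forall>x\<in>\<Omega>. u 0 x = 0)"

text \<open>\<open>u\<close> is the maximal classical solution and \<open>T\<close> its existence time \<open>T\<^sub>f\<close>: there is no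
  proper extension of \<open>u\<close>. Values of \<open>u\<close> outside \<open>[0,T) \<times> closure \<Omega>\<close> are irrelevant.\<close>

definition maximal_classical_solution ::
  "real \<Rightarrow> 'a::euclidean_space set \<Rightarrow> ('a \<Rightarrow> real) \<Rightarrow> ereal \<Rightarrow> (real \<Rightarrow> 'a \<Rightarrow> real) \<Rightarrow> bool" where
  "maximal_classical_solution p \<Omega> f T u \<longleftrightarrow>
     classical_solution p \<Omega> f T u \<and>
     \<not> (\<exists>T' v. T < T' \<and> classical_solution p \<Omega> f T' v \<and>
          (\<forall>t x. 0 \<le> t \<and> ereal t < T \<and> x \<in> closure \<Omega> \<longrightarrow> v t x = u t x))"

definition touchdown_set ::
  "'a::euclidean_space set \<Rightarrow> ereal \<Rightarrow> (real \<Rightarrow> 'a \<Rightarrow> real) \<Rightarrow> 'a set" where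
  "touchdown_set \<Omega> T u =
     {x0 \<in> closure \<Omega>. \<exists>(t :: nat \<Rightarrow> real) x.
        (\<forall>i. 0 < t i \<and> ereal (t i) < T \<and> x i \<in> \<Omega>) \<and>
        x \<longlonglongrightarrow> x0 \<and> incseq t \<and> (\<lambda>i. ereal (t i)) \<longlonglongrightarrow> T \<and>
        (\<lambda>i. u (t i) (x i)) \<longlonglongrightarrow> 1}"

end

theory Submission
  imports Defs
begin

text \<open>
  Write $v = 1-u$, so that $v_t - \Delta v = -f v^{-p}$ and touchdown means $v \to 0$.

  The function $(v, \varphi) \mapsto (v^{p+1} - \varphi^{p+1})^{1/(p+1)}$ is concave, positively
  homogeneous of degree one, increasing in $v$ and decreasing in $\varphi$. Therefore, if $v$ solves
  the equation and $\varphi \ge 0$ is a subsolution of the \<^emph>\<open>linear\<close> heat equation, then this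
  function of $v$ and $\varphi$ is a supersolution of the same nonlinear equation with the same
  $f$. Comparing it with the time translate $v(t+s, \cdot)$ shows that an inequality
  \[ v(t,x)^{p+1} - v(t+s,x)^{p+1} \ge \varphi(t,x)^{p+1} \]
  propagates from the parabolic boundary into the interior (\<open>gain_above_heat_subsolution\<close>). It
  replaces the bound $u_t \ge \varepsilon \varphi^{p+1} (1-u)^{-p}$ on the time derivative; the
  difference in time requires no regularity of $u_t$.

  On the ball where $f \ge r$ the inequality holds at time $0$ with
  $\varphi^{p+1}$ a fixed multiple of $s$ (\<open>gain_initial\<close>). Explicit heat subsolutions with growing
  support carry it to balls in the interior, along chains of balls and with a constant that is
  uniform by compactness (\<open>spreads_uniformly\<close>), and finally to the full interior balls that touch the boundary,
  where $\varphi$ is bounded below by a multiple of the distance $\delta$ to the boundary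
  (\<open>gain_spreads_from_ball\<close>, \<open>uniform_interior_balls\<close>). The time available for this is bounded
  below because $u \le 1/2$ on an initial interval that depends on $M$ and $p$ only
  (\<open>touchdown_time_lower_bound\<close>), and above by $T \le M$. Letting $s$ tend to $T - t$ yields the type I
  estimate
  \[ v(t,x)^{p+1} \ge C\, \delta(x_0)^{p+1} (T - t) \]
  for $x$ near $x_0$ and $t$ near $T$.

  If $(p+1) f(x_0)$ is smaller than $C \delta(x_0)^{p+1}$, then near $x_0$ the source term can lower
  $v$ only at a rate that the type I estimate makes integrable with room to spare, and a barrier
  keeps $v$ away from $0$ at $x_0$ (\<open>no_touchdown_if_small_profile\<close>). This gives
  \<open>theorem1p1\<close> with $\gamma_0 = C/(p+1)$.
\<close>

section \<open>The heat operator and the maximum principle\<close>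

text \<open>\<open>L\<close> is the value of $(\partial_t - \Delta) g$ at \<open>(t, x)\<close>. A relation instead of a
  function, so that differentiability and value are asserted together, and second derivatives along
  coordinate lines instead of Frechet derivatives, so that barriers and linear combinations are
  handled by one-variable calculus.\<close>

definition has_heat_op :: "(real \<Rightarrow> 'a::euclidean_space \<Rightarrow> real) \<Rightarrow> real \<Rightarrow> 'a \<Rightarrow> real \<Rightarrow> bool" where
  "has_heat_op g t x L \<longleftrightarrow>
     (\<exists>gt D2. ((\<lambda>s. g s x) has_real_derivative gt) (at t) \<and>
        (\<forall>b\<in>Basis. \<exists>g'.
           (\<forall>\<^sub>F y in nhds 0. ((\<lambda>y. g t (x + y *\<^sub>R b)) has_real_derivative g' y) (at y)) \<and>
           (g' has_real_derivative D2 b) (at 0)) \<and>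
        L = gt - (\<Sum>b\<in>Basis. D2 b))"

lemma has_heat_op_add:
  assumes "has_heat_op g t x L" and "has_heat_op h t x L'"
  shows "has_heat_op (\<lambda>t x. g t x + h t x) t x (L + L')"
proof -
  obtain gt D where gt: "((\<lambda>s. g s x) has_real_derivative gt) (at t)" and
    D: "\<And>b. b \<in> Basis \<Longrightarrow> \<exists>g'. (\<forall>\<^sub>F y in nhds 0. ((\<lambda>y. g t (x + y *\<^sub>R b)) has_real_derivative g' y) (at y)) \<and>
           (g' has_real_derivative D b) (at 0)" and L: "L = gt - (\<Sum>b\<in>Basis. D b)"
    using assms(1) unfolding has_heat_op_def by blast
  obtain ht D' where ht: "((\<lambda>s. h s x) has_real_derivative ht) (at t)" and
    D': "\<And>b. b \<in> Basis \<Longrightarrow> \<exists>g'. (\<forall>\<^sub>F y in nhds 0. ((\<lambda>y. h t (x + y *\<^sub>R b)) has_real_derivative g' y) (at y)) \<and>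
           (g' has_real_derivative D' b) (at 0)" and L': "L' = ht - (\<Sum>b\<in>Basis. D' b)"
    using assms(2) unfolding has_heat_op_def by blast
  show ?thesis unfolding has_heat_op_def
  proof (intro exI[of _ "gt + ht"] exI[of _ "\<lambda>b. D b + D' b"] conjI ballI)
    show "((\<lambda>s. g s x + h s x) has_real_derivative gt + ht) (at t)"
      by (intro DERIV_add gt ht)
    show "L + L' = gt + ht - (\<Sum>b\<in>Basis. D b + D' b)"
      by (simp add: L L' sum.distrib)
    fix b :: 'a assume b: "b \<in> Basis"
    obtain g' where g': "\<forall>\<^sub>F y in nhds 0. ((\<lambda>y. g t (x + y *\<^sub>R b)) has_real_derivative g' y) (at y)"
      "(g' has_real_derivative D b) (at 0)" using D[OF b] by blast
    obtain h' where h': "\<forall>\<^sub>F y in nhds 0. ((\<lambda>y. h t (x + y *\<^sub>R b)) has_real_derivative h' y) (at y)"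
      "(h' has_real_derivative D' b) (at 0)" using D'[OF b] by blast
    have "\<forall>\<^sub>F y in nhds 0. ((\<lambda>y. g t (x + y *\<^sub>R b) + h t (x + y *\<^sub>R b)) has_real_derivative g' y + h' y) (at y)"
      using g'(1) h'(1) by eventually_elim (rule DERIV_add)
    moreover have "((\<lambda>y. g' y + h' y) has_real_derivative D b + D' b) (at 0)"
      by (intro DERIV_add g' h')
    ultimately show "\<exists>k. (\<forall>\<^sub>F y in nhds 0. ((\<lambda>y. g t (x + y *\<^sub>R b) + h t (x + y *\<^sub>R b)) has_real_derivative k y) (at y)) \<and>
           (k has_real_derivative D b + D' b) (at 0)" by (intro exI conjI)
  qed
qed

lemma has_heat_op_cmult:
  assumes "has_heat_op g t x L"
  shows "has_heat_op (\<lambda>t x. a * g t x) t x (a * L)"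
proof -
  obtain gt D where gt: "((\<lambda>s. g s x) has_real_derivative gt) (at t)" and
    D: "\<And>b. b \<in> Basis \<Longrightarrow> \<exists>g'. (\<forall>\<^sub>F y in nhds 0. ((\<lambda>y. g t (x + y *\<^sub>R b)) has_real_derivative g' y) (at y)) \<and>
           (g' has_real_derivative D b) (at 0)" and L: "L = gt - (\<Sum>b\<in>Basis. D b)"
    using assms(1) unfolding has_heat_op_def by blast
  show ?thesis unfolding has_heat_op_def
  proof (intro exI[of _ "a * gt"] exI[of _ "\<lambda>b. a * D b"] conjI ballI)
    show "((\<lambda>s. a * g s x) has_real_derivative a * gt) (at t)"
      by (intro DERIV_cmult gt)
    show "a * L = a * gt - (\<Sum>b\<in>Basis. a * D b)"
      by (simp add: L sum_distrib_left right_diff_distrib)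
    fix b :: 'a assume b: "b \<in> Basis"
    obtain g' where g': "\<forall>\<^sub>F y in nhds 0. ((\<lambda>y. g t (x + y *\<^sub>R b)) has_real_derivative g' y) (at y)"
      "(g' has_real_derivative D b) (at 0)" using D[OF b] by blast
    have "\<forall>\<^sub>F y in nhds 0. ((\<lambda>y. a * g t (x + y *\<^sub>R b)) has_real_derivative a * g' y) (at y)"
      using g'(1) by eventually_elim (rule DERIV_cmult)
    moreover have "((\<lambda>y. a * g' y) has_real_derivative a * D b) (at 0)"
      by (intro DERIV_cmult g')
    ultimately show "\<exists>k. (\<forall>\<^sub>F y in nhds 0. ((\<lambda>y. a * g t (x + y *\<^sub>R b)) has_real_derivative k y) (at y)) \<and>
           (k has_real_derivative a * D b) (at 0)" by (intro exI conjI)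
  qed
qed

lemma has_heat_op_time:
  assumes "(k has_real_derivative k') (at t)"
  shows "has_heat_op (\<lambda>t x. k t) t x k'"
  unfolding has_heat_op_def
  by (intro exI[of _ k'] exI[of _ "\<lambda>_. 0"] conjI ballI exI[of _ "\<lambda>_. 0"] assms) auto

lemma second_derivative_at_min_nonneg:
  fixes k :: "real \<Rightarrow> real"
  assumes min: "\<forall>\<^sub>F y in nhds 0. k 0 \<le> k y"
    and k': "\<forall>\<^sub>F y in nhds 0. (k has_real_derivative k' y) (at y)"
    and k'': "(k' has_real_derivative d) (at 0)"
  shows "0 \<le> d"
proof (rule ccontr)
  assume "\<not> 0 \<le> d"
  obtain e where e: "e > 0" and "\<And>y. dist y 0 < e \<Longrightarrow> k 0 \<le> k y \<and> (k has_real_derivative k' y) (at y)"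
    using eventually_conj[OF min k'] unfolding eventually_nhds_metric by blast
  then have emin: "\<And>y. \<bar>y\<bar> < e \<Longrightarrow> k 0 \<le> k y" and ed: "\<And>y. \<bar>y\<bar> < e \<Longrightarrow> (k has_real_derivative k' y) (at y)"
    by (auto simp: dist_real_def)
  have k0: "k' 0 = 0"
    by (rule DERIV_local_min[OF ed[of 0] e]) (use e emin in auto)
  obtain e' where e': "e' > 0" "\<And>h. 0 < h \<Longrightarrow> h < e' \<Longrightarrow> k' 0 > k' (0 + h)"
    using DERIV_neg_dec_right[OF k''] \<open>\<not> 0 \<le> d\<close> by auto
  define h where "h = min e e' / 2"
  have h: "0 < h" "h < e" "h < e'" using e e' by (auto simp: h_def)
  have "k h < k 0"
  proof (rule DERIV_neg_imp_decreasing_open[OF h(1)])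
    show "\<exists>y. DERIV k x :> y \<and> y < 0" if "0 < x" "x < h" for x
      using ed[of x] e'(2)[of x] k0 that h by (intro exI[of _ "k' x"]) auto
    show "continuous_on {0..h} k"
      by (intro continuous_at_imp_continuous_on ballI DERIV_isCont[OF ed]) (use h in auto)
  qed
  then show False using emin[of h] h by auto
qed

text \<open>The pointwise maximum principle. At \<open>(t, x)\<close> the function \<open>Z\<close> reaches its minimum
  \<open>0\<close> over all earlier times and nearby points, so its time derivative is at most \<open>0\<close> there, and
  all its second spatial derivatives are at least \<open>0\<close>.\<close>

lemma heat_op_at_contact:
  assumes Z: "has_heat_op Z t x L" and "t0 < t" and U: "open U" "x \<in> U"
    and contact: "Z t x = 0"
    and nonneg: "\<And>s y. t0 \<le> s \<Longrightarrow> s \<le> t \<Longrightarrow> y \<in> U \<Longrightarrow> 0 \<le> Z s y"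
  shows "L \<le> 0"
proof -
  obtain gt D where gt: "((\<lambda>s. Z s x) has_real_derivative gt) (at t)" and
    D: "\<And>b. b \<in> Basis \<Longrightarrow> \<exists>g'. (\<forall>\<^sub>F y in nhds 0. ((\<lambda>y. Z t (x + y *\<^sub>R b)) has_real_derivative g' y) (at y)) \<and>
           (g' has_real_derivative D b) (at 0)" and L: "L = gt - (\<Sum>b\<in>Basis. D b)"
    using Z unfolding has_heat_op_def by blast
  have "gt \<le> 0"
  proof (rule ccontr)
    assume "\<not> gt \<le> 0"
    then obtain e where e: "e > 0" "\<And>h. 0 < h \<Longrightarrow> h < e \<Longrightarrow> Z (t - h) x < Z t x"
      using DERIV_pos_inc_left[OF gt] by auto
    define h where "h = min e (t - t0) / 2"
    have "0 < h" "h < e" "h < t - t0" using e \<open>t0 < t\<close> by (auto simp: h_def)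
    then show False using e(2)[of h] nonneg[of "t - h" x] U contact by auto
  qed
  moreover have "0 \<le> D b" if b: "b \<in> Basis" for b
  proof -
    obtain g' where g': "\<forall>\<^sub>F y in nhds 0. ((\<lambda>y. Z t (x + y *\<^sub>R b)) has_real_derivative g' y) (at y)"
      "(g' has_real_derivative D b) (at 0)" using D[OF b] by blast
    have "((\<lambda>y. x + y *\<^sub>R b) \<longlongrightarrow> x + 0 *\<^sub>R b) (nhds 0)"
      by (intro tendsto_intros filterlim_ident)
    then have "\<forall>\<^sub>F y in nhds 0. x + y *\<^sub>R b \<in> U"
      using U by (auto dest: topological_tendstoD)
    then have "\<forall>\<^sub>F y in nhds 0. Z t (x + 0 *\<^sub>R b) \<le> Z t (x + y *\<^sub>R b)"
      by eventually_elim (use contact nonneg[of t] \<open>t0 < t\<close> in auto)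
    then show ?thesis using second_derivative_at_min_nonneg[OF _ g'] by simp
  qed
  then have "0 \<le> (\<Sum>b\<in>Basis. D b)" by (intro sum_nonneg) auto
  ultimately show ?thesis using L by linarith
qed

text \<open>If \<open>W\<close> were not positive, the compact set where it is at most \<open>0\<close> would contain a point of
  smallest time. That point is off the parabolic boundary, and by continuity \<open>W\<close> vanishes there
  while being nonnegative at all earlier times. All comparison results below exclude such a first
  contact by computing the heat operator at it.\<close>

lemma parabolic_first_contact:
  fixes W :: "real \<Rightarrow> 'a::euclidean_space \<Rightarrow> real"
  assumes U: "bounded U" and cont: "continuous_on ({t0..t1} \<times> closure U) (\<lambda>(t, x). W t x)"
    and init: "\<And>x. x \<in> closure U \<Longrightarrow> 0 < W t0 x"
    and lateral: "\<And>t x. t0 \<le> t \<Longrightarrow> t \<le> t1 \<Longrightarrow> x \<in> frontier U \<Longrightarrow> 0 < W t x"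
    and contact: "\<And>t x. t0 < t \<Longrightarrow> t \<le> t1 \<Longrightarrow> x \<in> U \<Longrightarrow> W t x = 0 \<Longrightarrow>
           (\<And>s y. t0 \<le> s \<Longrightarrow> s \<le> t \<Longrightarrow> y \<in> closure U \<Longrightarrow> 0 \<le> W s y) \<Longrightarrow> False"
    and t: "t0 \<le> t" "t \<le> t1" and x: "x \<in> closure U"
  shows "0 < W t x"
proof (rule ccontr)
  assume neg: "\<not> 0 < W t x"
  let ?Q = "{t0..t1} \<times> closure U"
  define Z where "Z = {z \<in> ?Q. (\<lambda>(t, x). W t x) z \<le> 0}"
  have cQ: "compact ?Q" using U by (intro compact_Times) (auto simp: compact_closure)
  have "closed ?Q" by (intro closed_Times) auto
  then have "closed Z"
    unfolding Z_def by (intro continuous_on_closed_Collect_le cont continuous_on_const)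
  with cQ have "compact Z"
    using compact_Int_closed[of ?Q Z] by (simp add: Z_def Int_absorb1 Collect_conj_eq)
  moreover have "(t, x) \<in> Z" using neg t x by (auto simp: Z_def)
  ultimately obtain t' x' where first: "(t', x') \<in> Z" "\<And>s y. (s, y) \<in> Z \<Longrightarrow> t' \<le> s"
    using continuous_attains_inf[of Z fst] by (force intro: continuous_on_fst continuous_on_id)
  then have t': "t0 \<le> t'" "t' \<le> t1" and x': "x' \<in> closure U" and "W t' x' \<le> 0"
    by (auto simp: Z_def)
  have "t0 < t'" using t' init[OF x'] \<open>W t' x' \<le> 0\<close> by (cases "t' = t0") auto
  have "x' \<notin> frontier U" using lateral[OF t'] \<open>W t' x' \<le> 0\<close> by fastforce
  then have "x' \<in> U" using x' interior_subset[of U] by (auto simp: frontier_def)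
  have before: "0 < W s y" if "t0 \<le> s" "s < t'" "y \<in> closure U" for s y
    using first(2)[of s y] that t' by (force simp: Z_def)
  have upto: "0 \<le> W s y" if s: "t0 \<le> s" "s \<le> t'" and y: "y \<in> closure U" for s y
  proof (cases "s = t'")
    case True
    have "continuous_on {t0..t1} (\<lambda>s. W s y)"
      using continuous_on_compose2[OF cont, of "{t0..t1}" "\<lambda>s. (s, y)"] y
      by (force intro!: continuous_on_Pair continuous_on_const continuous_on_id)
    then have "((\<lambda>s. W s y) \<longlongrightarrow> W t' y) (at t' within {t0..t1})"
      using t' by (auto simp: continuous_on_def)
    then have "((\<lambda>s. W s y) \<longlongrightarrow> W t' y) (at t' within {t0<..<t'})"
      by (rule tendsto_within_subset) (use t' in auto)
    moreover have "\<forall>\<^sub>F s in at t' within {t0<..<t'}. 0 \<le> W s y"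
      using before y by (auto simp: eventually_at_filter intro!: always_eventually order_less_imp_le)
    moreover have "at t' within {t0<..<t'} \<noteq> bot"
      using \<open>t0 < t'\<close> by (simp add: trivial_limit_within islimpt_greaterThanLessThan2)
    ultimately show ?thesis using True tendsto_lowerbound by blast
  qed (use before that in force)
  show False
    by (rule contact[OF \<open>t0 < t'\<close> t'(2) \<open>x' \<in> U\<close>])
      (use upto[OF t'(1) order_refl x'] upto \<open>W t' x' \<le> 0\<close> in auto)
qed

text \<open>The barriers below are all of the form $a(t) + b(t) E(|x-y|^2)$, and
  $\Delta E(|x-y|^2) = 2 n E' + 4 |x-y|^2 E''$.\<close>

lemma has_heat_op_radial:
  fixes y :: "'a::euclidean_space" and a b E E' :: "real \<Rightarrow> real"
  assumes a: "(a has_real_derivative a') (at t)" and b: "(b has_real_derivative b') (at t)"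
    and E': "\<And>\<sigma>. (E has_real_derivative E' \<sigma>) (at \<sigma>)"
    and E'': "(E' has_real_derivative E'') (at ((norm (x - y))\<^sup>2))"
  shows "has_heat_op (\<lambda>t x. a t + b t * E ((norm (x - y))\<^sup>2)) t x
    (a' + b' * E ((norm (x - y))\<^sup>2)
      - b t * (2 * DIM('a) * E' ((norm (x - y))\<^sup>2) + 4 * (norm (x - y))\<^sup>2 * E''))"
proof -
  define \<sigma> where "\<sigma> = (norm (x - y))\<^sup>2"
  define q where "q e s = \<sigma> + 2 * s * ((x - y) \<bullet> e) + s\<^sup>2" for e :: 'a and s
  have line: "(norm (x + s *\<^sub>R e - y))\<^sup>2 = q e s" if "e \<in> Basis" for e s
    using that unfolding q_def \<sigma>_def power2_norm_eq_inner
    by (simp add: algebra_simps inner_commute power2_eq_square)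
  have q0: "q e 0 = \<sigma>" for e by (simp add: q_def)
  have qd: "(q e has_real_derivative 2 * ((x - y) \<bullet> e) + 2 * s) (at s)" for e s
    unfolding q_def by (auto intro!: derivative_eq_intros)
  define k' where "k' e s = b t * (E' (q e s) * (2 * ((x - y) \<bullet> e) + 2 * s))" for e s
  define D2 where "D2 e = b t * (2 * E' \<sigma> + 4 * E'' * ((x - y) \<bullet> e)\<^sup>2)" for e
  have d1: "((\<lambda>s. a t + b t * E ((norm (x + s *\<^sub>R e - y))\<^sup>2)) has_real_derivative k' e s) (at s)"
    if "e \<in> Basis" for e s
    unfolding line[OF that] k'_def
    by (auto intro!: derivative_eq_intros DERIV_chain2[OF E' qd])
  have "((\<lambda>s. E' (q e s)) has_real_derivative E'' * (2 * ((x - y) \<bullet> e) + 2 * 0)) (at 0)" for e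
    by (rule DERIV_chain2[OF _ qd]) (use E'' in \<open>simp add: q0 \<sigma>_def\<close>)
  then have d2: "(k' e has_real_derivative D2 e) (at 0)" for e
    unfolding k'_def D2_def
    by (auto intro!: derivative_eq_intros simp: q0 power2_eq_square algebra_simps)
  have "(\<Sum>e\<in>Basis. ((x - y) \<bullet> e)\<^sup>2) = \<sigma>"
    unfolding \<sigma>_def power2_norm_eq_inner by (subst euclidean_inner) (simp add: power2_eq_square)
  then have sum: "(\<Sum>e\<in>Basis. D2 e) = b t * (2 * DIM('a) * E' \<sigma> + 4 * \<sigma> * E'')"
    unfolding D2_def by (simp add: sum.distrib algebra_simps flip: sum_distrib_left)
  show ?thesis
    unfolding has_heat_op_def
  proof (intro exI[of _ "a' + b' * E \<sigma>"] exI[of _ D2] conjI ballI)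
    show "((\<lambda>s. a s + b s * E ((norm (x - y))\<^sup>2)) has_real_derivative a' + b' * E \<sigma>) (at t)"
      unfolding \<sigma>_def[symmetric] by (auto intro!: derivative_eq_intros a b)
  next
    fix e :: 'a assume e: "e \<in> Basis"
    show "\<exists>g'. (\<forall>\<^sub>F s in nhds 0. ((\<lambda>s. a t + b t * E ((norm (x + s *\<^sub>R e - y))\<^sup>2))
             has_real_derivative g' s) (at s)) \<and> (g' has_real_derivative D2 e) (at 0)"
      by (rule exI[of _ "k' e"]) (use d1[OF e] d2[of e] in auto)
  qed (simp add: sum \<sigma>_def)
qed

section \<open>Elementary bounds for solutions\<close>

lemma has_real_derivative_along_line:
  assumes "g differentiable (at (x + s *\<^sub>R b))"
  shows "((\<lambda>s. g (x + s *\<^sub>R b)) has_real_derivative partial b g (x + s *\<^sub>R b)) (at s)"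
proof -
  have "(g has_derivative frechet_derivative g (at (x + s *\<^sub>R b))) (at (x + s *\<^sub>R b))"
    using assms by (simp add: frechet_derivative_works)
  then have "((\<lambda>s. g (x + s *\<^sub>R b)) has_derivative
      (\<lambda>h. frechet_derivative g (at (x + s *\<^sub>R b)) (h *\<^sub>R b))) (at s)"
    by (rule has_derivative_compose[rotated]) (auto intro!: derivative_eq_intros)
  moreover have "frechet_derivative g (at (x + s *\<^sub>R b)) (h *\<^sub>R b) = h * partial b g (x + s *\<^sub>R b)" for h
    using linear_scale[OF linear_frechet_derivative[OF assms]] by (simp add: partial_def)
  ultimately show ?thesis
    unfolding has_field_derivative_def by (elim has_derivative_eq_rhs) (simp add: fun_eq_iff mult.commute)
qed

locale membrane =
  fixes p :: real and \<Omega> :: "'a::euclidean_space set" and f :: "'a \<Rightarrow> real"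
    and T :: ereal and u :: "real \<Rightarrow> 'a \<Rightarrow> real"
  assumes p_pos: "0 < p"
    and open_domain: "open \<Omega>" and bounded_domain: "bounded \<Omega>"
    and f_nonneg: "x \<in> closure \<Omega> \<Longrightarrow> 0 \<le> f x"
    and f_bounded: "\<exists>F. \<forall>x\<in>\<Omega>. f x \<le> F"
    and solution: "classical_solution p \<Omega> f T u"
begin

lemma before_existence_time: "s \<le> t \<Longrightarrow> ereal t < T \<Longrightarrow> ereal s < T"
  by (rule le_less_trans[of _ "ereal t"]) simp

lemma u_less_one: "0 \<le> t \<Longrightarrow> ereal t < T \<Longrightarrow> x \<in> closure \<Omega> \<Longrightarrow> u t x < 1"
  using solution unfolding classical_solution_def by blast

lemma continuous_u_on:
  assumes "0 \<le> t0" "ereal t1 < T" "S \<subseteq> closure \<Omega>"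
  shows "continuous_on ({t0..t1} \<times> S) (\<lambda>(t, x). u t x)"
proof (rule continuous_on_subset)
  show "continuous_on ({t. 0 \<le> t \<and> ereal t < T} \<times> closure \<Omega>) (\<lambda>(t, x). u t x)"
    using solution unfolding classical_solution_def by blast
  show "{t0..t1} \<times> S \<subseteq> {t. 0 \<le> t \<and> ereal t < T} \<times> closure \<Omega>"
    using assms before_existence_time[of _ t1] by auto
qed

lemma existence_time_pos: "0 < T"
  using solution unfolding classical_solution_def by blast

lemma u_initial:
  assumes "x \<in> closure \<Omega>" shows "u 0 x = 0"
proof -
  have "continuous_on ({0..0} \<times> closure \<Omega>) (\<lambda>(t, x). u t x)"
    by (rule continuous_u_on) (use existence_time_pos in \<open>auto simp: zero_ereal_def\<close>)
  then have "continuous_on (closure \<Omega>) (\<lambda>x. u 0 x)"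
    using continuous_on_compose2[of "{0..0} \<times> closure \<Omega>" "\<lambda>(t, x). u t x" "closure \<Omega>" "\<lambda>x. (0, x)"]
    by (force intro!: continuous_on_Pair continuous_on_const continuous_on_id)
  moreover have "u 0 x = 0" if "x \<in> \<Omega>" for x
    using solution that unfolding classical_solution_def by blast
  ultimately show ?thesis using continuous_constant_on_closure assms by blast
qed

lemma u_boundary:
  assumes "0 \<le> t" "ereal t < T" "x \<in> frontier \<Omega>" shows "u t x = 0"
proof (cases "t = 0")
  case True then show ?thesis using u_initial assms by (auto simp: frontier_def)
next
  case False then show ?thesis using solution assms unfolding classical_solution_def by auto
qed

lemma heat_op_u:
  assumes t: "0 < t" "ereal t < T" and x: "x \<in> \<Omega>"
  shows "has_heat_op u t x (f x * (1 - u t x) powr (- p))"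
proof -
  have C21: "C21_on T \<Omega> u"
    and eq: "deriv (\<lambda>s. u s x) t - laplacian (u t) x = f x * (1 - u t x) powr (- p)"
    using solution t x unfolding classical_solution_def by blast+
  have dt: "(\<lambda>s. u s x) differentiable (at t)"
    and C2: "Ck_on 2 \<Omega> (u t)"
    using C21 t x unfolding C21_on_def Let_def by auto
  have d1: "u t differentiable (at y)" if "y \<in> \<Omega>" for y
    using C2 that by (simp add: numeral_2_eq_2)
  have d2: "partial b (u t) differentiable (at y)" if "y \<in> \<Omega>" "b \<in> Basis" for y b
    using C2 that by (simp add: numeral_2_eq_2)
  show ?thesis
    unfolding has_heat_op_def
  proof (intro exI[of _ "deriv (\<lambda>s. u s x) t"] exI[of _ "\<lambda>b. partial b (partial b (u t)) x"] conjI ballI)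
    show "((\<lambda>s. u s x) has_real_derivative deriv (\<lambda>s. u s x) t) (at t)"
      using dt by (simp add: DERIV_deriv_iff_real_differentiable)
    show "f x * (1 - u t x) powr (- p) =
      deriv (\<lambda>s. u s x) t - (\<Sum>b\<in>Basis. partial b (partial b (u t)) x)"
      using eq by (simp add: laplacian_def)
    fix b :: 'a assume b: "b \<in> Basis"
    have "((\<lambda>y. x + y *\<^sub>R b) \<longlongrightarrow> x + 0 *\<^sub>R b) (nhds 0)"
      by (intro tendsto_intros filterlim_ident)
    then have "\<forall>\<^sub>F y in nhds 0. x + y *\<^sub>R b \<in> \<Omega>"
      using x open_domain by (auto dest: topological_tendstoD)
    then have "\<forall>\<^sub>F y in nhds 0. ((\<lambda>y. u t (x + y *\<^sub>R b)) has_real_derivative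
        partial b (u t) (x + y *\<^sub>R b)) (at y)"
      by eventually_elim (rule has_real_derivative_along_line[OF d1])
    moreover have "((\<lambda>y. partial b (u t) (x + y *\<^sub>R b)) has_real_derivative
        partial b (partial b (u t)) x) (at 0)"
      using has_real_derivative_along_line[of "partial b (u t)" x 0 b] d2[OF x b] by simp
    ultimately show "\<exists>g'. (\<forall>\<^sub>F y in nhds 0. ((\<lambda>y. u t (x + y *\<^sub>R b)) has_real_derivative g' y) (at y)) \<and>
        (g' has_real_derivative partial b (partial b (u t)) x) (at 0)"
      by (intro exI conjI)
  qed
qed

text \<open>The extra term $\eta (1 + t)$ makes the comparison strict, so that a first contact contradicts
  \<open>heat_op_at_contact\<close>; afterwards $\eta \to 0$.\<close>

lemma heat_subsolution_below_u:
  assumes t1: "ereal t1 < T" and U: "open U" "U \<subseteq> \<Omega>"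
    and cont: "continuous_on ({0..t1} \<times> closure U) (\<lambda>(t, x). z t x)"
    and sub: "\<And>t x. 0 < t \<Longrightarrow> t \<le> t1 \<Longrightarrow> x \<in> U \<Longrightarrow>
        \<exists>L \<le> f x * (1 - u t x) powr (- p). has_heat_op z t x L"
    and init: "\<And>x. x \<in> closure U \<Longrightarrow> z 0 x \<le> u 0 x"
    and lateral: "\<And>t x. 0 \<le> t \<Longrightarrow> t \<le> t1 \<Longrightarrow> x \<in> frontier U \<Longrightarrow> z t x \<le> u t x"
    and t: "0 \<le> t" "t \<le> t1" and x: "x \<in> closure U"
  shows "z t x \<le> u t x"
proof (rule field_le_epsilon)
  fix e :: real assume "0 < e"
  define \<eta> where "\<eta> = e / (1 + t)"
  have "\<eta> > 0" using \<open>0 < e\<close> t by (simp add: \<eta>_def)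
  define W where "W t x = u t x + (- 1) * z t x + \<eta> * (1 + t)" for t x
  have Wpos: "0 < W t x"
  proof (rule parabolic_first_contact[where W=W and t=t and x=x and U=U and ?t0.0=0 and ?t1.0=t1])
    show "bounded U" using bounded_domain U bounded_subset by blast
    have "continuous_on ({0..t1} \<times> closure U) (\<lambda>(t, x). u t x)"
      using continuous_u_on t1 U closure_mono by blast
    then show "continuous_on ({0..t1} \<times> closure U) (\<lambda>(t, x). W t x)"
      using cont unfolding W_def case_prod_beta by (intro continuous_intros)
    show "0 < W 0 x" if "x \<in> closure U" for x
      using init[OF that] \<open>\<eta> > 0\<close> by (simp add: W_def)
    show "0 < W t x" if "0 \<le> t" "t \<le> t1" "x \<in> frontier U" for t x
    proof -
      have "0 < \<eta> * (1 + t)" using \<open>\<eta> > 0\<close> that by (intro mult_pos_pos) auto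
      then show ?thesis using lateral[OF that] by (simp add: W_def)
    qed
    fix t x assume t: "0 < t" "t \<le> t1" and x: "x \<in> U" and 0: "W t x = 0"
      and nonneg: "\<And>s y. 0 \<le> s \<Longrightarrow> s \<le> t \<Longrightarrow> y \<in> closure U \<Longrightarrow> 0 \<le> W s y"
    obtain L where L: "L \<le> f x * (1 - u t x) powr (- p)" "has_heat_op z t x L"
      using sub[OF t x] by blast
    have "ereal t < T" using before_existence_time[OF t(2) t1] .
    moreover have "((\<lambda>t. \<eta> * (1 + t)) has_real_derivative \<eta>) (at t)"
      by (auto intro!: derivative_eq_intros)
    ultimately have "has_heat_op W t x (f x * (1 - u t x) powr (- p) + (- 1) * L + \<eta>)"
      unfolding W_def[abs_def] using t x U L
      by (intro has_heat_op_add has_heat_op_cmult has_heat_op_time heat_op_u) auto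
    from heat_op_at_contact[OF this t(1) U(1) x 0] nonneg closure_subset[of U]
    show False using L \<open>\<eta> > 0\<close> by (auto simp: subset_iff)
  qed (use t x in auto)
  moreover have "\<eta> * (1 + t) = e" using t by (simp add: \<eta>_def)
  ultimately show "z t x \<le> u t x + e" by (simp add: W_def)
qed

lemma u_nonneg:
  assumes "0 \<le> t" "ereal t < T" "x \<in> closure \<Omega>"
  shows "0 \<le> u t x"
proof (rule heat_subsolution_below_u[where t=t and x=x and U=\<Omega> and z="\<lambda>_ _. 0" and ?t1.0=t])
  show "\<exists>L \<le> f y * (1 - u s y) powr (- p). has_heat_op (\<lambda>_ _. 0) s y L" if "y \<in> \<Omega>" for s y
    using has_heat_op_time[of "\<lambda>_. 0" 0 s y] f_nonneg[OF subsetD[OF closure_subset that]]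
    by (intro exI[of _ 0] conjI mult_nonneg_nonneg) simp_all
  show "0 \<le> u s y" if "0 \<le> s" "s \<le> t" "y \<in> frontier \<Omega>" for s y
    using u_boundary[OF that(1) before_existence_time[OF that(2) assms(2)] that(3)] by simp
qed (use assms open_domain u_initial in auto)

text \<open>The function $e\,t\,(r^2 - |x-c|^2)$ vanishes initially and on the sphere, and its heat operator
  $e\,(r^2 - |x-c|^2 + 2nt)$ stays below $k \le f \le f (1-u)^{-p}$.\<close>

lemma u_lower_bound_initial:
  fixes t :: real
  assumes r: "0 < r" "ball c r \<subseteq> \<Omega>" "\<And>x. x \<in> ball c r \<Longrightarrow> k \<le> f x"
    and e: "0 \<le> e" "e * (r\<^sup>2 + 2 * DIM('a) * t) \<le> k"
    and t: "0 \<le> t" "ereal t < T" and x: "x \<in> ball c r"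
  shows "e * t * (r\<^sup>2 - (norm (x - c))\<^sup>2) \<le> u t x"
proof -
  define z where
    "z t x = e * r\<^sup>2 * t + (- e * t) * (norm (x - c))\<^sup>2" for t x
  have cl: "closure (ball c r) \<subseteq> closure \<Omega>" using r closure_mono by blast
  have "z t x \<le> u t x"
  proof (rule heat_subsolution_below_u[where t=t and x=x and U="ball c r" and z=z and ?t1.0=t])
    show "continuous_on ({0..t} \<times> closure (ball c r)) (\<lambda>(t, x). z t x)"
      unfolding z_def case_prod_beta by (intro continuous_intros)
    show "z 0 y \<le> u 0 y" if "y \<in> closure (ball c r)" for y
      using u_initial[OF subsetD[OF cl that]] by (simp add: z_def)
    show "z s y \<le> u s y" if "0 \<le> s" "s \<le> t" "y \<in> frontier (ball c r)" for s y
    proof -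
      have "norm (y - c) = r" using that r by (simp add: frontier_ball dist_norm norm_minus_commute)
      moreover have "0 \<le> u s y"
        using that(1) before_existence_time[OF that(2) t(2)] subsetD[OF cl, of y] that(3)
        by (intro u_nonneg) (auto simp: frontier_def simp del: closure_ball)
      ultimately show ?thesis by (simp add: z_def algebra_simps)
    qed
    fix s y assume s: "0 < s" "s \<le> t" and y: "y \<in> ball c r"
    let ?L = "e * r\<^sup>2 + (- e) * (norm (y - c))\<^sup>2
      - (- e * s) * (2 * DIM('a) * (1::real) + 4 * (norm (y - c))\<^sup>2 * 0)"
    have "has_heat_op z s y ?L"
      unfolding z_def[abs_def]
      by (rule has_heat_op_radial[where a="\<lambda>t. e * r\<^sup>2 * t" and b="\<lambda>t. - e * t"
            and E="\<lambda>\<sigma>. \<sigma>" and E'="\<lambda>_. 1"])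
        (auto intro!: derivative_eq_intros)
    moreover have "?L \<le> f y * (1 - u s y) powr (- p)"
    proof -
      have y': "y \<in> closure \<Omega>" "ereal s < T"
        using y r closure_subset[of \<Omega>] before_existence_time[OF s(2) t(2)] by auto
      have "1 \<le> (1 - u s y) powr (- p)"
        using powr_mono2'[of "- p" "1 - u s y" 1] u_nonneg[of s y] u_less_one[of s y] p_pos s y'
        by simp
      then have "f y * 1 \<le> f y * (1 - u s y) powr (- p)"
        using f_nonneg[OF y'(1)] by (intro mult_left_mono)
      moreover have "?L \<le> e * r\<^sup>2 + e * (2 * DIM('a) * s)" using e by (simp add: algebra_simps)
      moreover have "e * (2 * DIM('a) * s) \<le> e * (2 * DIM('a) * t)"
        using e s by (intro mult_left_mono) auto
      moreover have "e * r\<^sup>2 + e * (2 * DIM('a) * t) \<le> k" using e(2) by (simp add: distrib_left)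
      ultimately show ?thesis using r(3)[OF y] by linarith
    qed
    ultimately show "\<exists>L \<le> f y * (1 - u s y) powr (- p). has_heat_op z s y L" by blast
  qed (use r t x in \<open>auto simp del: closure_ball intro: subsetD[OF closure_subset]\<close>)
  then show ?thesis by (simp add: z_def algebra_simps)
qed

text \<open>As long as $u \le 1/2$ the source term is at most $2^p F$, so $u$ stays below
  $1/4 + 2^{p+1} F t$, which does not exceed $1/2$ on the given time interval.\<close>

lemma u_upper_bound_initial:
  assumes F: "0 < F" "\<And>x. x \<in> \<Omega> \<Longrightarrow> f x \<le> F"
    and t: "0 \<le> t" "ereal t < T" "t \<le> 1 / (4 * F * 2 powr (p + 1))" and x: "x \<in> closure \<Omega>"
  shows "u t x < 1 / 2"
proof -
  define K where "K = F * 2 powr (p + 1)"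
  have K: "0 < K" using F by (simp add: K_def)
  define W where "W t x = (- 1) * u t x + (1 / 4 + K * t)" for t x
  have Kt: "K * s \<le> 1 / 4" if "s \<le> t" for s
  proof -
    have "K * s \<le> K * (1 / (4 * K))" using that t K by (intro mult_left_mono) (auto simp: K_def mult.assoc)
    then show ?thesis using K by simp
  qed
  have before: "ereal s < T" if "s \<le> t" for s
    using before_existence_time[OF that t(2)] .
  have "0 < W t x"
  proof (rule parabolic_first_contact[where W=W and t=t and x=x and U=\<Omega> and ?t0.0=0 and ?t1.0=t])
    have "continuous_on ({0..t} \<times> closure \<Omega>) (\<lambda>(t, x). u t x)"
      using continuous_u_on t by blast
    then show "continuous_on ({0..t} \<times> closure \<Omega>) (\<lambda>(t, x). W t x)"
      unfolding W_def case_prod_beta by (intro continuous_intros)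
    show "0 < W 0 y" if "y \<in> closure \<Omega>" for y
      using u_initial[OF that] by (simp add: W_def)
    show "0 < W s y" if "0 \<le> s" "s \<le> t" "y \<in> frontier \<Omega>" for s y
      using u_boundary[of s y] that before[of s] K by (simp add: W_def add_pos_nonneg)
    fix s y assume s: "0 < s" "s \<le> t" and y: "y \<in> \<Omega>" and 0: "W s y = 0"
      and nonneg: "\<And>s' y. 0 \<le> s' \<Longrightarrow> s' \<le> s \<Longrightarrow> y \<in> closure \<Omega> \<Longrightarrow> 0 \<le> W s' y"
    have "((\<lambda>t. 1 / 4 + K * t) has_real_derivative K) (at s)"
      by (auto intro!: derivative_eq_intros)
    then have "has_heat_op W s y ((- 1) * (f y * (1 - u s y) powr (- p)) + K)"
      unfolding W_def[abs_def] using s y before[of s]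
      by (intro has_heat_op_add has_heat_op_cmult has_heat_op_time heat_op_u) auto
    from heat_op_at_contact[OF this s(1) open_domain y 0]
    have "K \<le> f y * (1 - u s y) powr (- p)"
      using nonneg closure_subset[of \<Omega>] by (auto simp: subset_iff)
    also have "\<dots> \<le> F * 2 powr p"
    proof (rule mult_mono)
      have "1 / 2 \<le> 1 - u s y" using 0 Kt[OF s(2)] by (simp add: W_def)
      then have "(1 - u s y) powr (- p) \<le> (1 / 2) powr (- p)"
        using p_pos by (intro powr_mono2') auto
      then show "(1 - u s y) powr (- p) \<le> 2 powr p" by (simp add: powr_minus powr_divide)
    qed (use F y in auto)
    also have "\<dots> < K" using F by (simp add: K_def powr_add)
    finally show False by simp
  qed (use t x bounded_domain in auto)
  then show ?thesis using Kt[of t] by (simp add: W_def)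
qed

end

section \<open>The gain dominates powers of heat subsolutions\<close>

text \<open>The function $(v, w) \mapsto (v^{p+1} - w^{p+1})^{1/(p+1)}$ is concave and positively homogeneous
  of degree one, hence lies below its linear part at each point $(v_0, w_0)$. With
  $V = (v^{p+1} - w^{p+1})^{1/(p+1)}$ this linear part is $(v_0^p v - w_0^p w) / V_0^p$, and the
  inequality is the Hoelder inequality for two terms.\<close>

lemma powr_supporting_line:
  fixes p :: real
  assumes p: "0 < p" and pos: "0 < v0" "0 \<le> V0" "0 \<le> w0" "0 \<le> v" "0 \<le> V" "0 \<le> w"
    and base: "V0 powr (p + 1) + w0 powr (p + 1) = v0 powr (p + 1)"
    and point: "V powr (p + 1) + w powr (p + 1) = v powr (p + 1)"
  shows "V0 powr p * V + w0 powr p * w \<le> v0 powr p * v"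
proof (cases "v = 0")
  case True
  then have "V powr (p + 1) = 0" "w powr (p + 1) = 0"
    using point by (simp_all add: add_nonneg_eq_0_iff)
  then show ?thesis using True by simp
next
  case False
  then have v: "0 < v" using pos by simp
  have young: "a powr p * b \<le> p / (p + 1) * a powr (p + 1) + 1 / (p + 1) * b powr (p + 1)"
    if "0 \<le> a" "0 \<le> b" for a b
  proof (cases "a = 0 \<or> b = 0")
    case False
    then have "(a powr (p + 1)) powr (p / (p + 1)) * (b powr (p + 1)) powr (1 / (p + 1))
        \<le> p / (p + 1) * a powr (p + 1) + 1 / (p + 1) * b powr (p + 1)"
      using that p by (intro Youngs_inequality_0) (auto simp: field_simps)
    then show ?thesis using p that by (simp add: powr_powr)
  qed (use that p in auto)
  have "(V0 powr p * V + w0 powr p * w) / (v0 powr p * v) =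
      (V0 / v0) powr p * (V / v) + (w0 / v0) powr p * (w / v)"
    using pos v by (simp add: powr_divide add_divide_distrib)
  also have "\<dots> \<le> p / (p + 1) * ((V0 / v0) powr (p + 1) + (w0 / v0) powr (p + 1))
      + 1 / (p + 1) * ((V / v) powr (p + 1) + (w / v) powr (p + 1))"
    using young[of "V0 / v0" "V / v"] young[of "w0 / v0" "w / v"] pos v
    by (simp add: distrib_left)
  also have "(V0 / v0) powr (p + 1) + (w0 / v0) powr (p + 1) = 1"
    using pos base by (simp add: powr_divide flip: add_divide_distrib)
  also have "(V / v) powr (p + 1) + (w / v) powr (p + 1) = 1"
    using pos point v by (simp add: powr_divide flip: add_divide_distrib)
  also have "p / (p + 1) * 1 + 1 / (p + 1) * 1 = 1"
    using p by (simp add: field_simps)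
  finally show ?thesis using pos v by (simp add: divide_le_eq)
qed

lemma negative_powr_diff_le:
  fixes p :: real
  assumes p: "0 < p" and a: "0 < a" and b: "a \<le> b" "b \<le> c"
  shows "b powr (- p) - c powr (- p) \<le> p * a powr (- p - 1) * (c - b)"
proof (cases "b = c")
  case False
  then have "b < c" using b by simp
  have "\<exists>z. b < z \<and> z < c \<and> c powr (- p) - b powr (- p) = (c - b) * (- p * z powr (- p - 1))"
    by (rule MVT2[OF \<open>b < c\<close>]) (use a b in \<open>auto intro!: derivative_eq_intros\<close>)
  then obtain z where z: "b < z" "c powr (- p) - b powr (- p) = (c - b) * (- p * z powr (- p - 1))"
    by blast
  have "z powr (- p - 1) \<le> a powr (- p - 1)"
    using a b z p by (intro powr_mono2') auto
  then have "p * z powr (- p - 1) * (c - b) \<le> p * a powr (- p - 1) * (c - b)"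
    using p \<open>b < c\<close> by (intro mult_right_mono mult_left_mono) auto
  then show ?thesis using z by (simp add: algebra_simps)
qed simp

text \<open>The decrease of $(1-u)^{p+1}$ over a time lag \<open>s\<close>. Up to the factor \<open>s\<close> it is a finite
  difference version of $(p+1)(1-u)^p u_t$, so that $u_t \ge \varepsilon \varphi^{p+1} (1-u)^{-p}$
  becomes a lower bound for the gain by $(p+1) \varepsilon s \varphi^{p+1}$. Working with the
  difference avoids all differentiability questions about $u_t$.\<close>

definition gain :: "real \<Rightarrow> (real \<Rightarrow> 'a \<Rightarrow> real) \<Rightarrow> real \<Rightarrow> real \<Rightarrow> 'a \<Rightarrow> real" where
  "gain p u s t x = (1 - u t x) powr (p + 1) - (1 - u (t + s) x) powr (p + 1)"

context membrane
begin

text \<open>The core of the proof. Let $v = 1-u$, let $\hat v$ be $v$ shifted in time by \<open>s\<close>, and let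
  $V = (v^{p+1} - \varphi_+^{p+1})^{1/(p+1)}$. The claim is $\hat v \le V$. It holds because $V$ is a
  supersolution of the equation $v_t - \Delta v = -f v^{-p}$ satisfied by $v$ and $\hat v$: if
  $V = \alpha v + \beta \varphi$ to first order, then concavity gives
  \[ V_t - \Delta V \ge \alpha (v_t - \Delta v) + \beta (\varphi_t - \Delta \varphi)
     \ge - \alpha f v^{-p} = - f V^{-p}, \]
  since $\beta \le 0$, $\varphi_t \le \Delta \varphi$ and $\alpha = (v/V)^p$. The source
  term reproduces itself exactly, so \<open>\<phi>\<close> may be any subsolution of the linear heat equation, also
  one supported away from the set where \<open>f\<close> is positive.\<close>

lemma gain_above_heat_subsolution:
  fixes s t0 t1 :: real
  assumes time: "0 \<le> s" "0 \<le> t0" "ereal (t1 + s) < T" and U: "open U" "U \<subseteq> \<Omega>"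
    and cont: "continuous_on ({t0..t1} \<times> closure U) (\<lambda>(t, x). \<phi> t x)"
    and sub: "\<And>t x. t0 < t \<Longrightarrow> t \<le> t1 \<Longrightarrow> x \<in> U \<Longrightarrow> 0 < \<phi> t x \<Longrightarrow> \<exists>L\<le>0. has_heat_op \<phi> t x L"
    and init: "\<And>x. x \<in> closure U \<Longrightarrow> (max 0 (\<phi> t0 x)) powr (p + 1) \<le> gain p u s t0 x"
    and lateral: "\<And>t x. t0 \<le> t \<Longrightarrow> t \<le> t1 \<Longrightarrow> x \<in> frontier U \<Longrightarrow>
        (max 0 (\<phi> t x)) powr (p + 1) \<le> gain p u s t x"
    and t: "t0 \<le> t" "t \<le> t1" and x: "x \<in> closure U"
  shows "(max 0 (\<phi> t x)) powr (p + 1) \<le> gain p u s t x"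
proof -
  define v where "v t x = 1 - u t x" for t x
  define vh where "vh t x = 1 - u (t + s) x" for t x
  define w where "w t x = max 0 (\<phi> t x)" for t x
  define V where "V t x = (max 0 (v t x powr (p + 1) - w t x powr (p + 1))) powr (1 / (p + 1))" for t x
  let ?Q = "{t0..t1} \<times> closure U"
  have p1: "0 < p + 1" "p + 1 \<noteq> 0" using p_pos by auto
  have clU: "closure U \<subseteq> closure \<Omega>" using U closure_mono by blast
  have before: "ereal (t + s) < T" "ereal t < T" if "t \<le> t1" for t
    using before_existence_time[OF _ time(3)] that time by auto
  have vpos: "0 < v t x" "0 < vh t x" if "t0 \<le> t" "t \<le> t1" "x \<in> closure U" for t x
    using u_less_one[of t x] u_less_one[of "t + s" x] that before[of t] time clU
    by (auto simp: v_def vh_def)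
  have gain: "gain p u s t x = v t x powr (p + 1) - vh t x powr (p + 1)" for t x
    by (simp add: gain_def v_def vh_def)
  have cont_v: "continuous_on ?Q (\<lambda>(t, x). v t x)"
    using continuous_u_on[OF time(2) before(2)[OF order_refl] clU]
    unfolding v_def case_prod_beta by (intro continuous_intros)
  have "continuous_on ?Q (\<lambda>(t, x). u (t + s) x)"
    using continuous_on_compose2[OF continuous_u_on[of "t0 + s" "t1 + s" "closure U"],
        of ?Q "\<lambda>z. (fst z + s, snd z)"] time clU
    by (force simp: case_prod_beta intro!: continuous_intros)
  then have cont_vh: "continuous_on ?Q (\<lambda>(t, x). vh t x)"
    unfolding vh_def case_prod_beta by (intro continuous_intros)
  have cont_w: "continuous_on ?Q (\<lambda>(t, x). w t x)"
    using cont unfolding w_def case_prod_beta by (intro continuous_intros)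
  have cont_V: "continuous_on ?Q (\<lambda>(t, x). V t x)"
  proof -
    have "continuous_on ?Q (\<lambda>z. v (fst z) (snd z) powr (p + 1))"
      using cont_v[unfolded case_prod_beta] vpos p1
      by (intro continuous_on_powr' continuous_on_const) (auto intro: less_imp_le)
    moreover have "continuous_on ?Q (\<lambda>z. w (fst z) (snd z) powr (p + 1))"
      using cont_w[unfolded case_prod_beta] p1
      by (intro continuous_on_powr' continuous_on_const) (auto simp: w_def)
    ultimately have "continuous_on ?Q
        (\<lambda>z. max 0 (v (fst z) (snd z) powr (p + 1) - w (fst z) (snd z) powr (p + 1)))"
      by (intro continuous_on_max continuous_on_diff continuous_on_const)
    then show ?thesis
      unfolding V_def case_prod_beta
      by (rule continuous_on_powr'[OF _ continuous_on_const]) (use p1 in auto)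
  qed
  have V_ge: "vh t x \<le> V t x" if "w t x powr (p + 1) \<le> gain p u s t x" "0 < vh t x" for t x
  proof -
    have "(vh t x powr (p + 1)) powr (1 / (p + 1)) \<le> V t x"
      unfolding V_def using that p1 by (intro powr_mono2) (auto simp: gain)
    then show ?thesis using p1 that by (simp add: powr_powr)
  qed
  have V_pos: "V t x powr (p + 1) + w t x powr (p + 1) = v t x powr (p + 1)" if "0 < V t x" for t x
  proof -
    have "0 < v t x powr (p + 1) - w t x powr (p + 1)"
    proof (rule ccontr)
      assume "\<not> ?thesis"
      then have "V t x = 0" by (simp add: V_def)
      then show False using that by simp
    qed
    then show ?thesis using p1 by (simp add: V_def powr_powr)
  qed
  have "compact ?Q"
    using bounded_subset[OF bounded_domain U(2)] by (intro compact_Times) (auto simp: compact_closure)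
  then obtain z0 where z0: "z0 \<in> ?Q" "\<And>z. z \<in> ?Q \<Longrightarrow> (\<lambda>(t, x). vh t x) z0 \<le> (\<lambda>(t, x). vh t x) z"
    using continuous_attains_inf[OF _ _ cont_vh] t x by (metis SigmaI atLeastAtMost_iff empty_iff)
  define c where "c = (\<lambda>(t, x). vh t x) z0"
  have c: "0 < c" "\<And>t x. t0 \<le> t \<Longrightarrow> t \<le> t1 \<Longrightarrow> x \<in> closure U \<Longrightarrow> c \<le> vh t x"
    using z0 vpos by (fastforce simp: c_def split: prod.splits)+
  obtain F0 where F0: "\<And>x. x \<in> \<Omega> \<Longrightarrow> f x \<le> F0" using f_bounded by blast
  define F where "F = max 0 F0"
  have F: "0 \<le> F" "\<And>x. x \<in> \<Omega> \<Longrightarrow> f x \<le> F" using F0 by (force simp: F_def)+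
  \<comment> \<open>The factor of \<open>F\<close> is a Lipschitz constant of $z \mapsto z^{-p}$ on $z \ge c/2$.\<close>
  define K where "K = F * (p * (c / 2) powr (- p - 1)) + 1"
  have K: "0 \<le> K" using F p_pos by (simp add: K_def)
  have strict: "vh t x < V t x + \<eta> * exp (K * (t - t0))"
    if \<eta>: "0 < \<eta>" "\<eta> * exp (K * (t1 - t0)) \<le> c / 2" for \<eta>
  proof -
    define W where "W t x = V t x + (- 1) * vh t x + \<eta> * exp (K * (t - t0))" for t x
    have small: "\<eta> * exp (K * (t - t0)) \<le> c / 2" if "t \<le> t1" for t
    proof -
      have "\<eta> * exp (K * (t - t0)) \<le> \<eta> * exp (K * (t1 - t0))"
        using \<eta> K that by (intro mult_left_mono) (auto intro!: mult_left_mono)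
      then show ?thesis using \<eta>(2) by linarith
    qed
    have "0 < W t x"
    proof (rule parabolic_first_contact[where W=W and t=t and x=x and U=U and ?t0.0=t0 and ?t1.0=t1])
      show "bounded U" using bounded_domain U bounded_subset by blast
      show "continuous_on ?Q (\<lambda>(t, x). W t x)"
        using cont_V cont_vh unfolding W_def case_prod_beta by (intro continuous_intros)
      show "0 < W t0 y" if "y \<in> closure U" for y
      proof -
        have "vh t0 y \<le> V t0 y"
          using init[OF that] vpos[of t0 y] that t by (intro V_ge) (auto simp: w_def)
        then show ?thesis using \<eta> by (simp add: W_def)
      qed
      show "0 < W r y" if "t0 \<le> r" "r \<le> t1" "y \<in> frontier U" for r y
      proof -
        have "vh r y \<le> V r y"
          using lateral[OF that] vpos[of r y] that by (intro V_ge) (auto simp: w_def frontier_def)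
        then show ?thesis using \<eta> by (simp add: W_def add_nonneg_pos)
      qed
      fix r y assume r: "t0 < r" "r \<le> t1" and y: "y \<in> U" and 0: "W r y = 0"
        and nonneg: "\<And>s y. t0 \<le> s \<Longrightarrow> s \<le> r \<Longrightarrow> y \<in> closure U \<Longrightarrow> 0 \<le> W s y"
      have y': "y \<in> closure U" "y \<in> \<Omega>" using y U closure_subset by blast+
      have Vpos: "c / 2 \<le> V t x" if "t0 \<le> t" "t \<le> r" "x \<in> closure U" for t x
        using nonneg[OF that] c(2)[of t x] small[of t] that r by (simp add: W_def)
      have V0: "c / 2 \<le> V r y" "0 < V r y" using Vpos[of r y] r y' c by auto
      \<comment> \<open>Where \<open>\<phi>\<close> is not positive, \<open>w\<close> and the coefficient \<open>\<beta>\<close> vanish, and \<open>\<phi>\<close> may be replaced by \<open>0\<close>.\<close>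
      define \<psi> where "\<psi> = (if 0 < \<phi> r y then \<phi> else (\<lambda>_ _. 0))"
      have "\<exists>L\<le>0. has_heat_op \<psi> r y L"
      proof (cases "0 < \<phi> r y")
        case False
        moreover have "has_heat_op (\<lambda>_ _. 0) r y 0" by (rule has_heat_op_time) simp
        ultimately show ?thesis by (auto simp: \<psi>_def)
      qed (use sub[OF r y] in \<open>auto simp: \<psi>_def\<close>)
      then obtain L where L: "L \<le> 0" "has_heat_op \<psi> r y L" by blast
      have \<psi>: "\<psi> r y = w r y" "w r y powr p * \<psi> t x \<le> w r y powr p * w t x" for t x
        by (auto simp: \<psi>_def w_def intro!: mult_left_mono)
      have v0: "0 < v r y" using vpos[of r y] r y' by simp
      define \<alpha> where "\<alpha> = (v r y / V r y) powr p"
      define \<beta> where "\<beta> = - ((w r y / V r y) powr p)"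
      have \<beta>: "\<beta> \<le> 0" by (simp add: \<beta>_def)
      have scaled: "\<alpha> * a + \<beta> * b = (v r y powr p * a - w r y powr p * b) / V r y powr p" for a b
        using V0 v0 by (simp add: \<alpha>_def \<beta>_def powr_divide w_def diff_divide_distrib)
      have above: "V t x \<le> \<alpha> * v t x + \<beta> * \<psi> t x" if "t0 \<le> t" "t \<le> r" "x \<in> closure U" for t x
      proof -
        have "V r y powr p * V t x + w r y powr p * w t x \<le> v r y powr p * v t x"
          using V_pos[of r y] V_pos[of t x] V0 Vpos[OF that] c v0 vpos[of t x] that r
          by (intro powr_supporting_line[OF p_pos]) (auto simp: w_def)
        then have "V t x \<le> (v r y powr p * v t x - w r y powr p * w t x) / V r y powr p"
          using V0 by (simp add: pos_le_divide_eq algebra_simps)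
        also have "\<dots> \<le> (v r y powr p * v t x - w r y powr p * \<psi> t x) / V r y powr p"
          using V0 \<psi> by (intro divide_right_mono diff_left_mono) auto
        finally show ?thesis by (simp add: scaled)
      qed
      have at: "V r y = \<alpha> * v r y + \<beta> * \<psi> r y"
      proof -
        have "V r y powr p * V r y + w r y powr p * \<psi> r y = v r y powr p * v r y"
          using V_pos[of r y] V0 v0 \<psi>(1) by (simp add: powr_add w_def)
        then show ?thesis using V0 by (simp add: scaled field_simps)
      qed
      \<comment> \<open>\<open>Z\<close> is \<open>W\<close> with \<open>V\<close> replaced by its linear majorant; it touches \<open>0\<close> at the same point.\<close>
      define Z where "Z t x = \<alpha> * (1 + (- 1) * u t x) + \<beta> * \<psi> t x + (- 1) * (1 + (- 1) * u (t + s) x)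
         + \<eta> * exp (K * (t - t0))" for t x
      have Z: "Z t x = \<alpha> * v t x + \<beta> * \<psi> t x + (- 1) * vh t x + \<eta> * exp (K * (t - t0))" for t x
        by (simp add: Z_def v_def vh_def)
      have r_time: "0 < r" "0 < r + s" using r time by auto
      have "has_heat_op (\<lambda>t. u (t + s)) r y (f y * (1 - u (r + s) y) powr (- p))"
      proof -
        have "((\<lambda>t. u t y) has_real_derivative D) (at (r + s)) \<Longrightarrow>
            ((\<lambda>t. u (t + s) y) has_real_derivative D) (at r)" for D
          by (simp add: DERIV_shift)
        then show ?thesis
          using heat_op_u[OF r_time(2) before(1)[OF r(2)] y'(2)] unfolding has_heat_op_def by blast
      qed
      note hu = heat_op_u[OF r_time(1) before(2)[OF r(2)] y'(2)] this
      have one: "has_heat_op (\<lambda>t x. 1) r y 0" by (rule has_heat_op_time) simp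
      have expo: "((\<lambda>t. \<eta> * exp (K * (t - t0))) has_real_derivative \<eta> * (exp (K * (r - t0)) * K)) (at r)"
        by (auto intro!: derivative_eq_intros)
      have "has_heat_op Z r y (\<alpha> * (0 + (- 1) * (f y * (1 - u r y) powr (- p))) + \<beta> * L
          + (- 1) * (0 + (- 1) * (f y * (1 - u (r + s) y) powr (- p))) + \<eta> * (exp (K * (r - t0)) * K))"
        unfolding Z_def[abs_def]
        by (intro has_heat_op_add has_heat_op_cmult has_heat_op_time[OF expo] one hu L)
      moreover have "Z r y = 0" using 0 at by (simp add: Z W_def)
      moreover have "0 \<le> Z t x" if "t0 \<le> t" "t \<le> r" "x \<in> U" for t x
        using nonneg[of t x] above[of t x] that closure_subset[of U] by (auto simp: Z W_def)
      ultimately have "\<alpha> * (0 + (- 1) * (f y * (1 - u r y) powr (- p))) + \<beta> * L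
          + (- 1) * (0 + (- 1) * (f y * (1 - u (r + s) y) powr (- p))) + \<eta> * (exp (K * (r - t0)) * K) \<le> 0"
        by (rule heat_op_at_contact[OF _ r(1) U(1) y])
      then have "\<beta> * L + f y * vh r y powr (- p) + \<eta> * (exp (K * (r - t0)) * K)
          \<le> \<alpha> * (f y * v r y powr (- p))"
        by (simp add: v_def vh_def)
      moreover have "0 \<le> \<beta> * L" using \<beta> L by (simp add: mult_nonpos_nonpos)
      moreover have "\<alpha> * v r y powr (- p) = V r y powr (- p)"
        using V0 v0 by (simp add: \<alpha>_def powr_divide powr_minus field_simps)
      then have "\<alpha> * (f y * v r y powr (- p)) = f y * V r y powr (- p)"
        by (metis mult.left_commute)
      ultimately have "\<eta> * (exp (K * (r - t0)) * K) + f y * vh r y powr (- p) \<le> f y * V r y powr (- p)"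
        by linarith
      then have "\<eta> * exp (K * (r - t0)) * K \<le> f y * (V r y powr (- p) - vh r y powr (- p))"
        by (simp add: algebra_simps)
      also have "\<dots> \<le> f y * (p * (c / 2) powr (- p - 1) * (vh r y - V r y))"
      proof (rule mult_left_mono)
        have "0 < \<eta> * exp (K * (r - t0))" using \<eta> by simp
        then have "V r y \<le> vh r y" using 0 by (simp add: W_def)
        then show "V r y powr (- p) - vh r y powr (- p) \<le> p * (c / 2) powr (- p - 1) * (vh r y - V r y)"
          using V0 c(1) by (intro negative_powr_diff_le p_pos) auto
        show "0 \<le> f y" using f_nonneg y' clU by blast
      qed
      also have "\<dots> = f y * (p * (c / 2) powr (- p - 1)) * (\<eta> * exp (K * (r - t0)))"
        using 0 by (simp add: W_def)
      also have "\<dots> \<le> F * (p * (c / 2) powr (- p - 1)) * (\<eta> * exp (K * (r - t0)))"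
        using F(2)[OF y'(2)] p_pos \<eta> by (intro mult_right_mono) auto
      also have "\<dots> < \<eta> * exp (K * (r - t0)) * K"
        using \<eta> by (simp add: K_def algebra_simps)
      finally show False by simp
    qed (use t x in auto)
    then show ?thesis by (simp add: W_def)
  qed
  have "vh t x \<le> V t x"
  proof (rule field_le_epsilon)
    fix e :: real assume "0 < e"
    define \<eta> where "\<eta> = min e (c / 2) / exp (K * (t1 - t0))"
    have "vh t x < V t x + \<eta> * exp (K * (t - t0))"
      using \<open>0 < e\<close> c by (intro strict) (auto simp: \<eta>_def)
    also have "\<eta> * exp (K * (t - t0)) \<le> \<eta> * exp (K * (t1 - t0))"
      using K t \<open>0 < e\<close> c by (intro mult_left_mono) (auto simp: \<eta>_def intro!: mult_left_mono)
    also have "\<dots> \<le> e" by (simp add: \<eta>_def)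
    finally show "vh t x \<le> V t x + e" by simp
  qed
  moreover have vh: "0 < vh t x" using vpos[OF t x] by simp
  ultimately have "vh t x powr (p + 1) + w t x powr (p + 1) \<le> V t x powr (p + 1) + w t x powr (p + 1)"
    using p1 by (intro add_right_mono powr_mono2) auto
  also have "\<dots> = v t x powr (p + 1)" using \<open>vh t x \<le> V t x\<close> vh by (intro V_pos) simp
  finally show ?thesis by (simp add: gain w_def)
qed

text \<open>The solution is nondecreasing in time: the case $\varphi = 0$ of the comparison, where the initial
  condition holds since $u$ starts from its minimum $0$.\<close>

lemma gain_nonneg:
  assumes "0 \<le> s" "0 \<le> t" "ereal (t + s) < T" "x \<in> closure \<Omega>"
  shows "0 \<le> gain p u s t x"
proof -
  have "(max 0 0) powr (p + 1) \<le> gain p u s t x"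
  proof (rule gain_above_heat_subsolution[where \<phi>="\<lambda>_ _. 0" and U=\<Omega> and ?t0.0=0 and ?t1.0=t and t=t and x=x])
    show "(max 0 0) powr (p + 1) \<le> gain p u s 0 y" if "y \<in> closure \<Omega>" for y
    proof -
      have "ereal s < T" using before_existence_time[OF _ assms(3)] assms by auto
      then have "(1 - u s y) powr (p + 1) \<le> 1 powr (p + 1)"
        using u_nonneg[of s y] u_less_one[of s y] assms that p_pos by (intro powr_mono2) auto
      then show ?thesis using u_initial[OF that] p_pos by (simp add: gain_def)
    qed
    show "(max 0 0) powr (p + 1) \<le> gain p u s r y" if "0 \<le> r" "r \<le> t" "y \<in> frontier \<Omega>" for r y
      using u_boundary[of r y] u_boundary[of "r + s" y] that assms
        before_existence_time[OF _ assms(3), of r] before_existence_time[OF _ assms(3), of "r + s"]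
      by (simp add: gain_def)
  qed (use assms open_domain in auto)
  then show ?thesis by simp
qed

end

section \<open>Propagation of the gain\<close>

text \<open>The barrier is $\varphi = k e^{-\omega (t - t_0)} (e^{-\alpha |x-y|^2} - e^{-\alpha S(t)})$, where
  the squared radius $S$ of its support grows linearly from $\rho^2$ to $R^2$ during the time \<open>\<tau>\<close>. It
  is a subsolution of the heat equation in its support: away from the centre by the choice of $\alpha$,
  which makes the Laplacian of $e^{-\alpha|x-y|^2}$ large there, and near the centre, where $\varphi$ is bounded below, by
  the choice of the damping $\omega$. The final bound is linear in the distance to the sphere, as
  required for the power $\delta^{p+1}$, and \<open>\<theta>\<close> is uniform in the radius $R$ and the centre.\<close>

lemma gain_spreads_from_ball:
  fixes \<rho> R1 \<tau>1 \<tau>2 p :: real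
  assumes \<rho>: "0 < \<rho>" and \<tau>1: "0 < \<tau>1"
  shows "\<exists>\<theta>>0. \<forall>(\<Omega> :: 'a::euclidean_space set) f T u y R s t0 \<tau> k. membrane p \<Omega> f T u \<longrightarrow>
    \<rho> \<le> R \<and> R \<le> R1 \<and> ball y R \<subseteq> \<Omega> \<longrightarrow>
    0 \<le> s \<and> 0 \<le> t0 \<and> \<tau>1 \<le> \<tau> \<and> \<tau> \<le> \<tau>2 \<and> ereal (t0 + \<tau> + s) < T \<longrightarrow> 0 \<le> k \<longrightarrow>
    (\<forall>x\<in>ball y \<rho>. k powr (p + 1) \<le> gain p u s t0 x) \<longrightarrow>
    (\<forall>x\<in>ball y R. (\<theta> * k * (R\<^sup>2 - (norm (x - y))\<^sup>2)) powr (p + 1) \<le> gain p u s (t0 + \<tau>) x)"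
proof -
  define n where "n = real DIM('a)"
  define \<kappa>1 where "\<kappa>1 = R1\<^sup>2 / \<tau>1"
  define \<alpha> where "\<alpha> = (\<kappa>1 + 2 * n) / (2 * \<rho>\<^sup>2)"
  define \<mu> where "\<mu> = exp (- \<alpha> * (\<rho>\<^sup>2 / 2)) - exp (- \<alpha> * \<rho>\<^sup>2)"
  define \<omega> where "\<omega> = (\<alpha> * \<kappa>1 + 2 * n * \<alpha>) / \<mu>"
  define \<theta> where "\<theta> = exp (- \<omega> * \<tau>2) * (\<alpha> * exp (- \<alpha> * R1\<^sup>2))"
  have n: "1 \<le> n" using DIM_positive[where 'a='a] by (simp add: n_def)
  have \<kappa>1: "0 \<le> \<kappa>1" using \<tau>1 by (simp add: \<kappa>1_def)
  have \<alpha>: "0 < \<alpha>" using \<kappa>1 n \<rho> by (auto simp: \<alpha>_def intro!: divide_pos_pos add_nonneg_pos)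
  have \<alpha>\<rho>: "2 * \<rho>\<^sup>2 * \<alpha> = \<kappa>1 + 2 * n" using \<rho> by (simp add: \<alpha>_def)
  have \<mu>: "0 < \<mu>" using \<alpha> \<rho> by (simp add: \<mu>_def)
  have \<omega>: "0 \<le> \<omega>" "\<omega> * \<mu> = \<alpha> * \<kappa>1 + 2 * n * \<alpha>" using \<alpha> \<kappa>1 n \<mu> by (auto simp: \<omega>_def)
  have \<theta>: "0 < \<theta>" using \<alpha> by (simp add: \<theta>_def)
  have main: "(\<theta> * k * (R\<^sup>2 - (norm (x - y))\<^sup>2)) powr (p + 1) \<le> gain p u s (t0 + \<tau>) x"
    if "membrane p \<Omega> f T u" and R: "\<rho> \<le> R" "R \<le> R1" "ball y R \<subseteq> \<Omega>"
      and time: "0 \<le> s" "0 \<le> t0" "\<tau>1 \<le> \<tau>" "\<tau> \<le> \<tau>2" "ereal (t0 + \<tau> + s) < T" and k: "0 \<le> k"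
      and start: "\<And>x. x \<in> ball y \<rho> \<Longrightarrow> k powr (p + 1) \<le> gain p u s t0 x" and x: "x \<in> ball y R"
    for \<Omega> :: "'a set" and f T u y R s t0 \<tau> k x
  proof -
    interpret membrane p \<Omega> f T u by fact
    define \<kappa> where "\<kappa> = (R\<^sup>2 - \<rho>\<^sup>2) / \<tau>"
    \<comment> \<open>With this speed the support has radius \<open>\<rho>\<close> at time \<open>t0\<close> and \<open>R\<close> at time \<open>t0 + \<tau>\<close>.\<close>
    define S where "S t = \<rho>\<^sup>2 + \<kappa> * (t - t0)" for t
    define b where "b t = k * exp (- \<omega> * (t - t0))" for t
    define a where "a t = - (b t * exp (- \<alpha> * S t))" for t
    define E where "E = (\<lambda>\<sigma>. exp (- \<alpha> * \<sigma>))"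
    define \<phi> where "\<phi> t x = a t + b t * E ((norm (x - y))\<^sup>2)" for t x
    have Rpos: "0 < R" "R\<^sup>2 \<le> R1\<^sup>2" "\<rho>\<^sup>2 \<le> R\<^sup>2" using R \<rho> by (auto intro!: power_mono)
    have \<tau>: "0 < \<tau>" using time \<tau>1 by simp
    have \<kappa>: "0 \<le> \<kappa>" "\<kappa> \<le> \<kappa>1"
    proof -
      show "0 \<le> \<kappa>" using Rpos \<tau> by (simp add: \<kappa>_def)
      have "\<kappa> \<le> R1\<^sup>2 / \<tau>" unfolding \<kappa>_def using Rpos \<tau> \<rho> by (intro divide_right_mono) (auto intro: order_trans[OF _ Rpos(2)])
      also have "\<dots> \<le> \<kappa>1" unfolding \<kappa>1_def using time \<tau>1 by (intro divide_left_mono) auto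
      finally show "\<kappa> \<le> \<kappa>1" .
    qed
    have S_ge: "\<rho>\<^sup>2 \<le> S t" if "t0 \<le> t" for t using \<kappa> that by (simp add: S_def)
    have S_end: "S (t0 + \<tau>) = R\<^sup>2" using \<tau> by (simp add: S_def \<kappa>_def)
    have S_le: "S t \<le> R\<^sup>2" if "t \<le> t0 + \<tau>" for t
    proof -
      have "S t \<le> S (t0 + \<tau>)" unfolding S_def using \<kappa> that by (intro add_left_mono mult_left_mono) auto
      then show ?thesis by (simp add: S_end)
    qed
    have b: "0 \<le> b t" for t using k by (simp add: b_def)
    have \<phi>: "\<phi> t x = b t * (E ((norm (x - y))\<^sup>2) - exp (- \<alpha> * S t))" for t x
      by (simp add: \<phi>_def a_def algebra_simps)
    have closed_ball: "closure (ball y R) = cball y R" using Rpos by simp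
    have cl: "closure (ball y R) \<subseteq> closure \<Omega>" using R closure_mono by blast
    have nonneg: "0 \<le> gain p u s t x" if "t0 \<le> t" "t \<le> t0 + \<tau>" "x \<in> closure (ball y R)" for t x
      using that cl time before_existence_time[OF _ time(5), of "t + s"] by (intro gain_nonneg) auto
    have inside: "(norm (x - y))\<^sup>2 < S t" if "0 < \<phi> t x" for t x
    proof -
      have "0 < E ((norm (x - y))\<^sup>2) - exp (- \<alpha> * S t)"
        using that b[of t] unfolding \<phi> by (simp add: zero_less_mult_iff)
      then show ?thesis using \<alpha> by (simp add: E_def)
    qed
    have "(max 0 (\<phi> (t0 + \<tau>) x)) powr (p + 1) \<le> gain p u s (t0 + \<tau>) x"
    proof (rule gain_above_heat_subsolution[where \<phi>=\<phi> and U="ball y R" and ?t0.0=t0 and ?t1.0="t0 + \<tau>"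
          and t="t0 + \<tau>" and x=x])
      show "continuous_on ({t0..t0 + \<tau>} \<times> closure (ball y R)) (\<lambda>(t, x). \<phi> t x)"
        unfolding \<phi>_def a_def b_def S_def E_def case_prod_beta by (intro continuous_intros)
      show "(max 0 (\<phi> t0 x)) powr (p + 1) \<le> gain p u s t0 x" if x: "x \<in> closure (ball y R)" for x
      proof (cases "0 < \<phi> t0 x")
        case True
        then have "(norm (x - y))\<^sup>2 < \<rho>\<^sup>2" using inside[OF True] by (simp add: S_def)
        then have "norm (x - y) < \<rho>" using \<rho> by (simp add: power2_less_imp_less)
        then have "x \<in> ball y \<rho>" by (simp add: dist_norm norm_minus_commute)
        moreover have "\<phi> t0 x \<le> k"
        proof -
          have "E ((norm (x - y))\<^sup>2) \<le> 1" using \<alpha> by (simp add: E_def)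
          then have "E ((norm (x - y))\<^sup>2) - exp (- \<alpha> * S t0) \<le> 1" using exp_ge_zero[of "- \<alpha> * S t0"] by linarith
          then have "\<phi> t0 x \<le> b t0 * 1" unfolding \<phi> using b by (intro mult_left_mono)
          then show ?thesis by (simp add: b_def)
        qed
        then have "(max 0 (\<phi> t0 x)) powr (p + 1) \<le> k powr (p + 1)"
          using p_pos k by (intro powr_mono2) auto
        ultimately show ?thesis using start by fastforce
      next
        case False
        then show ?thesis using nonneg[OF _ _ x] p_pos \<tau> by simp
      qed
      show "(max 0 (\<phi> t x)) powr (p + 1) \<le> gain p u s t x"
        if t: "t0 \<le> t" "t \<le> t0 + \<tau>" and x: "x \<in> frontier (ball y R)" for t x
      proof -
        have "norm (x - y) = R" using x Rpos by (simp add: frontier_ball dist_norm norm_minus_commute)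
        then have "\<not> 0 < \<phi> t x" using inside[of t x] S_le[OF t(2)] by auto
        then show ?thesis using nonneg[OF t] p_pos x by (simp add: frontier_def)
      qed
      fix t x assume t: "t0 < t" "t \<le> t0 + \<tau>" and x: "x \<in> ball y R" and pos: "0 < \<phi> t x"
      define \<sigma> where "\<sigma> = (norm (x - y))\<^sup>2"
      have db: "(b has_real_derivative (- \<omega> * b t)) (at t)"
        unfolding b_def[abs_def] by (auto intro!: derivative_eq_intros)
      have da: "(a has_real_derivative ((\<omega> + \<alpha> * \<kappa>) * (b t * exp (- \<alpha> * S t)))) (at t)"
        unfolding a_def[abs_def] S_def
        by (auto intro!: derivative_eq_intros db simp: algebra_simps)
      have dE: "(E has_real_derivative - \<alpha> * E \<sigma>) (at \<sigma>)" for \<sigma>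
        unfolding E_def by (auto intro!: derivative_eq_intros)
      have dE': "((\<lambda>\<sigma>. - \<alpha> * E \<sigma>) has_real_derivative \<alpha>\<^sup>2 * E \<sigma>) (at \<sigma>)" for \<sigma>
        by (auto intro!: derivative_eq_intros dE simp: power2_eq_square)
      let ?e = "exp (- \<alpha> * S t)"
      let ?L = "(\<omega> + \<alpha> * \<kappa>) * (b t * ?e) + (- \<omega> * b t) * E \<sigma>
         - b t * (2 * DIM('a) * (- \<alpha> * E \<sigma>) + 4 * \<sigma> * (\<alpha>\<^sup>2 * E \<sigma>))"
      have "has_heat_op \<phi> t x ?L"
        unfolding \<phi>_def[abs_def] \<sigma>_def
        by (rule has_heat_op_radial[where a=a and b=b and E=E and E'="\<lambda>\<sigma>. - \<alpha> * E \<sigma>"]) (rule da db dE dE')+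
      moreover have "?L \<le> 0"
      proof -
        have e: "?e < E \<sigma>" using inside[OF pos] \<alpha> by (simp add: E_def \<sigma>_def)
        have \<sigma>: "0 \<le> \<sigma>" by (simp add: \<sigma>_def)
        have "\<omega> * ?e + \<alpha> * \<kappa> * ?e - \<omega> * E \<sigma> + 2 * n * \<alpha> * E \<sigma> - 4 * \<sigma> * \<alpha>\<^sup>2 * E \<sigma> \<le> 0"
        proof (cases "\<rho>\<^sup>2 / 2 \<le> \<sigma>")
          case True
          have "(\<kappa>1 + 2 * n) * \<alpha> * E \<sigma> \<le> 4 * \<sigma> * \<alpha>\<^sup>2 * E \<sigma>"
          proof -
            have "2 * \<rho>\<^sup>2 * \<alpha> * \<alpha> * E \<sigma> \<le> 4 * \<sigma> * \<alpha> * \<alpha> * E \<sigma>"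
              using True \<alpha> by (intro mult_right_mono) (auto simp: E_def)
            then show ?thesis unfolding \<alpha>\<rho> by (simp add: power2_eq_square mult.assoc)
          qed
          moreover have "\<omega> * ?e \<le> \<omega> * E \<sigma>" using \<omega> e by (intro mult_left_mono) auto
          moreover have "\<alpha> * \<kappa> * ?e \<le> \<alpha> * \<kappa>1 * E \<sigma>"
            using \<alpha> \<kappa> \<kappa>1 e by (intro mult_mono) auto
          ultimately show ?thesis by (simp add: algebra_simps)
        next
          case False
          have "?e \<le> exp (- \<alpha> * \<rho>\<^sup>2)" using S_ge[of t] t \<alpha> by simp
          moreover have "exp (- \<alpha> * (\<rho>\<^sup>2 / 2)) \<le> E \<sigma>" using False \<alpha> by (simp add: E_def)
          ultimately have "\<mu> \<le> E \<sigma> - ?e" unfolding \<mu>_def by linarith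
          then have "\<omega> * \<mu> \<le> \<omega> * (E \<sigma> - ?e)" using \<omega> by (intro mult_left_mono)
          moreover have "0 \<le> S t" using S_ge[of t] t zero_le_power2[of \<rho>] by linarith
          then have "E \<sigma> \<le> 1" "?e \<le> 1" using \<alpha> \<sigma> by (auto simp: E_def)
          then have "2 * n * \<alpha> * E \<sigma> \<le> 2 * n * \<alpha> * 1" "\<alpha> * \<kappa> * ?e \<le> \<alpha> * \<kappa>1 * 1"
            using n \<alpha> \<kappa> \<kappa>1 by (intro mult_left_mono mult_mono; simp)+
          moreover have "0 \<le> 4 * \<sigma> * \<alpha>\<^sup>2 * E \<sigma>" using \<sigma> by (simp add: E_def)
          moreover have "\<omega> * (E \<sigma> - ?e) = \<omega> * E \<sigma> - \<omega> * ?e" by (rule right_diff_distrib)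
          ultimately show ?thesis using \<omega>(2) unfolding mult_1_right by linarith
        qed
        then have "b t * (\<omega> * ?e + \<alpha> * \<kappa> * ?e - \<omega> * E \<sigma> + 2 * n * \<alpha> * E \<sigma> - 4 * \<sigma> * \<alpha>\<^sup>2 * E \<sigma>) \<le> 0"
          using b by (simp add: mult_nonneg_nonpos)
        then show ?thesis by (simp add: n_def algebra_simps)
      qed
      ultimately show "\<exists>L\<le>0. has_heat_op \<phi> t x L" by blast
    qed (use R time \<tau> x Rpos in auto)
    moreover have "(\<theta> * k * (R\<^sup>2 - (norm (x - y))\<^sup>2)) powr (p + 1) \<le> (max 0 (\<phi> (t0 + \<tau>) x)) powr (p + 1)"
    proof (rule powr_mono2)
      define \<sigma> where "\<sigma> = (norm (x - y))\<^sup>2"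
      have "norm (x - y) < R" using x by (simp add: dist_norm norm_minus_commute)
      then have \<sigma>: "0 \<le> R\<^sup>2 - \<sigma>" by (simp add: \<sigma>_def power_mono)
      then show "0 \<le> \<theta> * k * (R\<^sup>2 - (norm (x - y))\<^sup>2)" using \<theta> k by (simp add: \<sigma>_def)
      have "exp (- \<alpha> * R1\<^sup>2) * (\<alpha> * (R\<^sup>2 - \<sigma>)) \<le> exp (- \<alpha> * R\<^sup>2) * (exp (\<alpha> * (R\<^sup>2 - \<sigma>)) - 1)"
      proof (rule mult_mono)
        show "\<alpha> * (R\<^sup>2 - \<sigma>) \<le> exp (\<alpha> * (R\<^sup>2 - \<sigma>)) - 1"
          using exp_ge_add_one_self[of "\<alpha> * (R\<^sup>2 - \<sigma>)"] by linarith
      qed (use \<alpha> \<sigma> Rpos in auto)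
      also have "\<dots> = E \<sigma> - exp (- \<alpha> * R\<^sup>2)"
        unfolding E_def right_diff_distrib mult_1_right exp_add[symmetric] by (simp add: algebra_simps)
      finally have "exp (- \<omega> * \<tau>2) * (exp (- \<alpha> * R1\<^sup>2) * (\<alpha> * (R\<^sup>2 - \<sigma>)))
          \<le> exp (- \<omega> * \<tau>) * (E \<sigma> - exp (- \<alpha> * R\<^sup>2))"
        using \<omega> time \<alpha> \<sigma> by (intro mult_mono) (auto intro!: mult_left_mono)
      then have "k * (exp (- \<omega> * \<tau>2) * (exp (- \<alpha> * R1\<^sup>2) * (\<alpha> * (R\<^sup>2 - \<sigma>))))
          \<le> k * (exp (- \<omega> * \<tau>) * (E \<sigma> - exp (- \<alpha> * R\<^sup>2)))"
        using k by (rule mult_left_mono)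
      then have "\<theta> * k * (R\<^sup>2 - \<sigma>) \<le> \<phi> (t0 + \<tau>) x"
        unfolding \<phi> S_end by (simp add: \<theta>_def b_def \<sigma>_def mult_ac)
      then show "\<theta> * k * (R\<^sup>2 - (norm (x - y))\<^sup>2) \<le> max 0 (\<phi> (t0 + \<tau>) x)"
        by (simp add: \<sigma>_def)
    qed (use p_pos in simp)
    ultimately show ?thesis by linarith
  qed
  show ?thesis using \<theta> main by (intro exI[of _ \<theta>]) blast
qed

text \<open>A Harnack inequality for the gain, with a constant that is uniform over all solutions and all lags.
  The window of waiting times is part of the relation since a chain of two steps halves it.\<close>

definition spreads_by ::
  "real \<Rightarrow> real \<Rightarrow> real \<Rightarrow> real \<Rightarrow> 'a::euclidean_space set \<Rightarrow> 'a set \<Rightarrow> 'a set \<Rightarrow> bool" where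
  "spreads_by \<theta> \<tau>1 \<tau>2 p \<Omega> A B \<longleftrightarrow>
     (\<forall>f T u s t0 \<tau> k. membrane p \<Omega> f T u \<longrightarrow>
        0 \<le> s \<and> 0 \<le> t0 \<and> \<tau>1 \<le> \<tau> \<and> \<tau> \<le> \<tau>2 \<and> ereal (t0 + \<tau> + s) < T \<longrightarrow> 0 \<le> k \<longrightarrow>
        (\<forall>x\<in>A. k powr (p + 1) \<le> gain p u s t0 x) \<longrightarrow>
        (\<forall>x\<in>B. (\<theta> * k) powr (p + 1) \<le> gain p u s (t0 + \<tau>) x))"

definition spreads :: "real \<Rightarrow> 'a::euclidean_space set \<Rightarrow> 'a set \<Rightarrow> 'a set \<Rightarrow> bool" where
  "spreads p \<Omega> A B \<longleftrightarrow> (\<forall>\<tau>1 \<tau>2. 0 < \<tau>1 \<longrightarrow> (\<exists>\<theta>>0. spreads_by \<theta> \<tau>1 \<tau>2 p \<Omega> A B))"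

lemma spreads_by_mono:
  assumes "spreads_by \<theta> \<tau>1 \<tau>2 p \<Omega> A B" and "A \<subseteq> A'" "B' \<subseteq> B" and "0 \<le> \<theta>'" "\<theta>' \<le> \<theta>" and p: "0 < p"
  shows "spreads_by \<theta>' \<tau>1 \<tau>2 p \<Omega> A' B'"
  unfolding spreads_by_def
proof (intro allI impI ballI)
  fix f T u s t0 \<tau> k x
  assume *: "membrane p \<Omega> f T u"
    "0 \<le> s \<and> 0 \<le> t0 \<and> \<tau>1 \<le> \<tau> \<and> \<tau> \<le> \<tau>2 \<and> ereal (t0 + \<tau> + s) < T" and k: "0 \<le> k"
    and start: "\<forall>x\<in>A'. k powr (p + 1) \<le> gain p u s t0 x" and x: "x \<in> B'"
  have "(\<theta>' * k) powr (p + 1) \<le> (\<theta> * k) powr (p + 1)"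
    using assms(4,5) k p by (intro powr_mono2 mult_right_mono) auto
  also have "\<dots> \<le> gain p u s (t0 + \<tau>) x"
    using assms(1)[unfolded spreads_by_def, rule_format, OF * k, of x] start x assms(2,3) by blast
  finally show "(\<theta>' * k) powr (p + 1) \<le> gain p u s (t0 + \<tau>) x" .
qed

lemma spreads_mono:
  assumes "spreads p \<Omega> A B" and "A \<subseteq> A'" "B' \<subseteq> B" and "0 < p"
  shows "spreads p \<Omega> A' B'"
  unfolding spreads_def
proof (intro allI impI)
  fix \<tau>1 \<tau>2 :: real assume "0 < \<tau>1"
  then obtain \<theta> where "0 < \<theta>" "spreads_by \<theta> \<tau>1 \<tau>2 p \<Omega> A B"
    using assms(1) unfolding spreads_def by blast
  then show "\<exists>\<theta>>0. spreads_by \<theta> \<tau>1 \<tau>2 p \<Omega> A' B'"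
    using spreads_by_mono[OF _ assms(2,3) _ order_refl assms(4)] by (intro exI[of _ \<theta>]) auto
qed

lemma spreads_trans:
  assumes AB: "spreads p \<Omega> A B" and BC: "spreads p \<Omega> B C"
  shows "spreads p \<Omega> A C"
  unfolding spreads_def
proof (intro allI impI)
  fix \<tau>1 \<tau>2 :: real assume "0 < \<tau>1"
  then obtain \<theta> \<theta>' where \<theta>: "0 < \<theta>" "spreads_by \<theta> (\<tau>1 / 2) (\<tau>2 / 2) p \<Omega> A B"
    and \<theta>': "0 < \<theta>'" "spreads_by \<theta>' (\<tau>1 / 2) (\<tau>2 / 2) p \<Omega> B C"
    using AB BC unfolding spreads_def by (metis half_gt_zero)
  have "spreads_by (\<theta>' * \<theta>) \<tau>1 \<tau>2 p \<Omega> A C"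
    unfolding spreads_by_def
  proof (intro allI impI)
    fix f T u s t0 \<tau> k
    assume sol: "membrane p \<Omega> f T u"
      and time: "0 \<le> s \<and> 0 \<le> t0 \<and> \<tau>1 \<le> \<tau> \<and> \<tau> \<le> \<tau>2 \<and> ereal (t0 + \<tau> + s) < T" and k: "0 \<le> k"
      and start: "\<forall>x\<in>A. k powr (p + 1) \<le> gain p u s t0 x"
    have \<tau>: "0 < \<tau>" using time \<open>0 < \<tau>1\<close> by simp
    have "ereal (t0 + \<tau> / 2 + s) < T"
      using membrane.before_existence_time[OF sol, of "t0 + \<tau> / 2 + s" "t0 + \<tau> + s"] time \<tau> by simp
    then have mid: "\<forall>x\<in>B. (\<theta> * k) powr (p + 1) \<le> gain p u s (t0 + \<tau> / 2) x"
      using \<theta>(2) sol time k start unfolding spreads_by_def by auto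
    have "\<forall>x\<in>C. (\<theta>' * (\<theta> * k)) powr (p + 1) \<le> gain p u s (t0 + \<tau> / 2 + \<tau> / 2) x"
    proof
      fix x assume "x \<in> C"
      show "(\<theta>' * (\<theta> * k)) powr (p + 1) \<le> gain p u s (t0 + \<tau> / 2 + \<tau> / 2) x"
        by (rule \<theta>'(2)[unfolded spreads_by_def, rule_format, OF sol _ _ _ \<open>x \<in> C\<close>])
          (use time k \<theta> \<tau> mid in \<open>auto simp: algebra_simps\<close>)
    qed
    moreover have "t0 + \<tau> / 2 + \<tau> / 2 = t0 + \<tau>" by simp
    ultimately show "\<forall>x\<in>C. (\<theta>' * \<theta> * k) powr (p + 1) \<le> gain p u s (t0 + \<tau>) x"
      by (simp only: mult.assoc)
  qed
  then show "\<exists>\<theta>>0. spreads_by \<theta> \<tau>1 \<tau>2 p \<Omega> A C" using \<theta>(1) \<theta>'(1)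
    by (intro exI[of _ "\<theta>' * \<theta>"] conjI mult_pos_pos)
qed

lemma spreads_concentric:
  fixes \<Omega> :: "'a::euclidean_space set"
  assumes p: "0 < p" and \<rho>: "0 < \<rho>" and R: "ball y R \<subseteq> \<Omega>" "R' < R"
  shows "spreads p \<Omega> (ball y \<rho>) (ball y R')"
proof (cases "0 < R'")
  case True
  define \<rho>' where "\<rho>' = min \<rho> R"
  have \<rho>': "0 < \<rho>'" "\<rho>' \<le> R" "ball y \<rho>' \<subseteq> ball y \<rho>" using \<rho> True R by (auto simp: \<rho>'_def)
  have "spreads p \<Omega> (ball y \<rho>') (ball y R')"
    unfolding spreads_def
  proof (intro allI impI)
    fix \<tau>1 \<tau>2 :: real assume "0 < \<tau>1"
    obtain \<theta> where \<theta>: "0 < \<theta>" and step: "\<And>(\<Omega> :: 'a set) f T u y R' s t0 \<tau> k. membrane p \<Omega> f T u \<Longrightarrow>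
      \<rho>' \<le> R' \<and> R' \<le> R \<and> ball y R' \<subseteq> \<Omega> \<Longrightarrow>
      0 \<le> s \<and> 0 \<le> t0 \<and> \<tau>1 \<le> \<tau> \<and> \<tau> \<le> \<tau>2 \<and> ereal (t0 + \<tau> + s) < T \<Longrightarrow> 0 \<le> k \<Longrightarrow>
      (\<forall>x\<in>ball y \<rho>'. k powr (p + 1) \<le> gain p u s t0 x) \<Longrightarrow>
      (\<forall>x\<in>ball y R'. (\<theta> * k * (R'\<^sup>2 - (norm (x - y))\<^sup>2)) powr (p + 1) \<le> gain p u s (t0 + \<tau>) x)"
      using gain_spreads_from_ball[OF \<rho>'(1) \<open>0 < \<tau>1\<close>, of p R \<tau>2, where 'a='a] by blast
    define c where "c = R\<^sup>2 - R'\<^sup>2"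
    have c: "0 < c" using R True by (simp add: c_def power_strict_mono)
    have "spreads_by (\<theta> * c) \<tau>1 \<tau>2 p \<Omega> (ball y \<rho>') (ball y R')"
      unfolding spreads_by_def
    proof (intro allI impI ballI)
      fix f T u s t0 \<tau> k x
      assume *: "membrane p \<Omega> f T u"
        and time: "0 \<le> s \<and> 0 \<le> t0 \<and> \<tau>1 \<le> \<tau> \<and> \<tau> \<le> \<tau>2 \<and> ereal (t0 + \<tau> + s) < T" and k: "0 \<le> k"
        and start: "\<forall>x\<in>ball y \<rho>'. k powr (p + 1) \<le> gain p u s t0 x" and x: "x \<in> ball y R'"
      have "norm (x - y) \<le> R'" using x by (simp add: dist_norm norm_minus_commute)
      then have "c \<le> R\<^sup>2 - (norm (x - y))\<^sup>2" by (simp add: c_def power_mono)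
      then have "(\<theta> * c * k) powr (p + 1) \<le> (\<theta> * k * (R\<^sup>2 - (norm (x - y))\<^sup>2)) powr (p + 1)"
        using c \<theta> k p mult_left_mono[of c "R\<^sup>2 - (norm (x - y))\<^sup>2" "\<theta> * k"]
        by (intro powr_mono2) (auto simp: mult_ac)
      also have "\<dots> \<le> gain p u s (t0 + \<tau>) x"
        using step[OF * _ time k start, of R] \<rho>' R x by auto
      finally show "(\<theta> * c * k) powr (p + 1) \<le> gain p u s (t0 + \<tau>) x" .
    qed
    then show "\<exists>\<theta>>0. spreads_by \<theta> \<tau>1 \<tau>2 p \<Omega> (ball y \<rho>') (ball y R')"
      using \<theta> c by (intro exI[of _ "\<theta> * c"]) auto
  qed
  then show ?thesis by (rule spreads_mono[OF _ \<rho>'(3) order_refl p])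
next
  case False
  then have "x \<notin> ball y R'" for x using zero_le_dist[of y x] unfolding mem_ball by linarith
  then show ?thesis
    unfolding spreads_def spreads_by_def by (intro allI impI exI[of _ 1] conjI ballI) (simp, blast)
qed

text \<open>A Harnack chain: the set of points near which the gain is controlled is open by
  \<open>spreads_concentric\<close>, and relatively closed since the radius of the balls used near a point \<open>z\<close>
  depends on \<open>z\<close> only.\<close>

lemma spreads_between_balls:
  fixes \<Omega> :: "'a::euclidean_space set"
  assumes p: "0 < p" and \<Omega>: "open \<Omega>" "connected \<Omega>"
    and a: "a \<in> \<Omega>" "0 < \<rho>" and b: "ball b R \<subseteq> \<Omega>" "R' < R"
  shows "spreads p \<Omega> (ball a \<rho>) (ball b R')"
proof (cases "0 < R'")
  case True
  define P where "P y \<longleftrightarrow> (\<exists>\<epsilon>>0. spreads p \<Omega> (ball a \<rho>) (ball y \<epsilon>))" for y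
  have "P b"
  proof (rule connected_induction_simple[OF \<Omega>(2) a(1)])
    show "b \<in> \<Omega>" using b True by auto
    obtain e where "0 < e" "ball a e \<subseteq> \<Omega>" using \<Omega>(1) a(1) by (auto simp: open_contains_ball)
    then show "P a" using spreads_concentric[OF p a(2), of a e \<Omega> "e / 2"]
      unfolding P_def by (intro exI[of _ "e / 2"]) auto
    fix z assume "z \<in> \<Omega>"
    then obtain e where e: "0 < e" "ball z e \<subseteq> \<Omega>" using \<Omega>(1) by (auto simp: open_contains_ball)
    show "\<exists>N. openin (top_of_set \<Omega>) N \<and> z \<in> N \<and> (\<forall>x\<in>N. \<forall>y\<in>N. P x \<longrightarrow> P y)"
    proof (intro exI conjI ballI impI)
      \<comment> \<open>Any two points of this ball are at distance less than \<open>e/2\<close>, and balls of radius \<open>3e/4\<close> around them lie in \<open>\<Omega>\<close>.\<close>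
      show "openin (top_of_set \<Omega>) (ball z (e / 4))"
        using e subset_ball[of "e / 4" e z] \<Omega>(1) by (simp add: openin_open_eq)
      show "z \<in> ball z (e / 4)" using e by simp
      fix x y assume x: "x \<in> ball z (e / 4)" and y: "y \<in> ball z (e / 4)" and "P x"
      then obtain \<epsilon> where \<epsilon>: "0 < \<epsilon>" "spreads p \<Omega> (ball a \<rho>) (ball x \<epsilon>)" by (auto simp: P_def)
      have "ball x (3 * e / 4) \<subseteq> ball z e"
      proof
        fix w assume "w \<in> ball x (3 * e / 4)"
        then show "w \<in> ball z e" using x dist_triangle[of z w x] by simp
      qed
      then have "spreads p \<Omega> (ball x \<epsilon>) (ball x (5 * e / 8))"
        using e \<epsilon> by (intro spreads_concentric[OF p, where R="3 * e / 4"]) auto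
      with \<epsilon> have "spreads p \<Omega> (ball a \<rho>) (ball x (5 * e / 8))" by (metis spreads_trans)
      moreover have "ball y (e / 8) \<subseteq> ball x (5 * e / 8)"
      proof
        fix w assume "w \<in> ball y (e / 8)"
        then show "w \<in> ball x (5 * e / 8)"
          using x y dist_triangle[of x w y] dist_triangle[of x y z] by (simp add: dist_commute)
      qed
      ultimately have "spreads p \<Omega> (ball a \<rho>) (ball y (e / 8))"
        by (rule spreads_mono[OF _ order_refl _ p])
      then show "P y" using e unfolding P_def by (intro exI[of _ "e / 8"]) auto
    qed
  qed
  then obtain \<epsilon> where "0 < \<epsilon>" "spreads p \<Omega> (ball a \<rho>) (ball b \<epsilon>)" by (auto simp: P_def)
  then show ?thesis using spreads_trans[OF _ spreads_concentric[OF p _ b]] by simp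
next
  case False
  then have "x \<notin> ball b R'" for x using zero_le_dist[of b x] unfolding mem_ball by linarith
  then show ?thesis
    unfolding spreads_def spreads_by_def by (intro allI impI exI[of _ 1] conjI ballI) (simp, blast)
qed

text \<open>The set of admissible centres is compact. Balls of radius \<open>r/4\<close> around finitely many centres cover
  it, so the smallest of finitely many factors works for all pairs of balls.\<close>

lemma spreads_uniformly:
  fixes \<Omega> :: "'a::euclidean_space set"
  assumes p: "0 < p" and \<Omega>: "open \<Omega>" "connected \<Omega>" "bounded \<Omega>" and r: "0 < r" and \<tau>1: "0 < \<tau>1"
  shows "\<exists>\<theta>>0. \<forall>a b. ball a r \<subseteq> \<Omega> \<and> ball b r \<subseteq> \<Omega> \<longrightarrow>
    spreads_by \<theta> \<tau>1 \<tau>2 p \<Omega> (ball a (r / 2)) (ball b (r / 2))"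
proof -
  define K where "K = {y. ball y r \<subseteq> \<Omega>}"
  have "K \<subseteq> \<Omega>" using r by (auto simp: K_def)
  have "closed K"
    unfolding closed_sequential_limits
  proof (intro allI impI, elim conjE)
    fix X y assume X: "\<forall>n. X n \<in> K" "X \<longlonglongrightarrow> y"
    show "y \<in> K" unfolding K_def
    proof (intro CollectI subsetI)
      fix x assume "x \<in> ball y r"
      moreover have "(\<lambda>n. dist (X n) x) \<longlonglongrightarrow> dist y x" using X by (intro tendsto_intros)
      ultimately have "\<forall>\<^sub>F n in sequentially. dist (X n) x < r" by (auto dest: order_tendstoD)
      then obtain n where "dist (X n) x < r" using eventually_happens'[OF sequentially_bot] by blast
      then show "x \<in> \<Omega>" using X(1)[rule_format, of n] by (auto simp: K_def)
    qed
  qed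
  then have "compact K"
    using bounded_subset[OF \<Omega>(3) \<open>K \<subseteq> \<Omega>\<close>] by (simp add: compact_eq_bounded_closed)
  moreover have "K \<subseteq> (\<Union>y\<in>K. ball y (r / 4))" using r by force
  ultimately obtain N where N: "N \<subseteq> K" "finite N" "K \<subseteq> (\<Union>y\<in>N. ball y (r / 4))"
    using compactE_image[of K K "\<lambda>y. ball y (r / 4)"] open_ball by metis
  have "\<exists>\<theta>>0. spreads_by \<theta> \<tau>1 \<tau>2 p \<Omega> (ball a (r / 4)) (ball b (3 * r / 4))"
    if "a \<in> N" "b \<in> N" for a b
  proof -
    have "a \<in> \<Omega>" "ball b r \<subseteq> \<Omega>" using that N(1) \<open>K \<subseteq> \<Omega>\<close> by (auto simp: K_def)
    then have "spreads p \<Omega> (ball a (r / 4)) (ball b (3 * r / 4))"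
      using r by (intro spreads_between_balls[OF p \<Omega>(1,2), where R=r]) auto
    then show ?thesis using \<tau>1 unfolding spreads_def by blast
  qed
  then obtain \<theta> where \<theta>: "\<And>a b. a \<in> N \<Longrightarrow> b \<in> N \<Longrightarrow>
      0 < \<theta> a b \<and> spreads_by (\<theta> a b) \<tau>1 \<tau>2 p \<Omega> (ball a (r / 4)) (ball b (3 * r / 4))"
    by metis
  define \<theta>0 where "\<theta>0 = Min (insert 1 ((\<lambda>(a, b). \<theta> a b) ` (N \<times> N)))"
  have pos: "0 < \<theta>0" using N(2) \<theta> by (auto simp: \<theta>0_def)
  have le: "\<theta>0 \<le> \<theta> a b" if "a \<in> N" "b \<in> N" for a b
    unfolding \<theta>0_def using N(2) that by (intro Min_le) auto
  have "spreads_by \<theta>0 \<tau>1 \<tau>2 p \<Omega> (ball a (r / 2)) (ball b (r / 2))"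
    if ab: "ball a r \<subseteq> \<Omega>" "ball b r \<subseteq> \<Omega>" for a b
  proof -
    have "a \<in> K" "b \<in> K" using ab by (auto simp: K_def)
    then have "a \<in> (\<Union>y\<in>N. ball y (r / 4))" "b \<in> (\<Union>y\<in>N. ball y (r / 4))" using N(3) by blast+
    then obtain a' b' where a': "a' \<in> N" "dist a' a < r / 4" and b': "b' \<in> N" "dist b' b < r / 4"
      by auto
    show ?thesis
    proof (rule spreads_by_mono[OF conjunct2[OF \<theta>[OF a'(1) b'(1)]]])
      show "ball a' (r / 4) \<subseteq> ball a (r / 2)"
      proof
        fix x assume "x \<in> ball a' (r / 4)"
        then show "x \<in> ball a (r / 2)" using a'(2) dist_triangle[of a x a'] by (simp add: dist_commute)
      qed
      show "ball b (r / 2) \<subseteq> ball b' (3 * r / 4)"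
      proof
        fix x assume "x \<in> ball b (r / 2)"
        then show "x \<in> ball b' (3 * r / 4)" using b'(2) dist_triangle[of b' x b] by simp
      qed
    qed (use pos le a' b' p in auto)
  qed
  then show ?thesis using pos by blast
qed

section \<open>Interior balls of smooth domains\<close>

text \<open>On a ball all partial derivatives up to order two are bounded by compactness; the mean value
  theorem turns this into a Lipschitz bound for the first partial derivatives and then into the
  quadratic Taylor bound.\<close>

lemma Ck_on_2_taylor_bound:
  fixes h :: "'a::euclidean_space \<Rightarrow> real"
  assumes h: "Ck_on 2 UNIV h"
  shows "\<exists>L\<ge>0. \<forall>a\<in>cball z \<rho>.
      (\<forall>w. \<bar>frechet_derivative h (at a) w\<bar> \<le> L * norm w) \<and>
      (\<forall>c\<in>cball z \<rho>. \<bar>h c - h a - frechet_derivative h (at a) (c - a)\<bar> \<le> L * (norm (c - a))\<^sup>2)"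
proof -
  let ?B = "cball z \<rho>"
  have dh: "h differentiable (at x)" for x using h by (simp add: numeral_2_eq_2)
  have dp: "partial b h differentiable (at x)" if "b \<in> Basis" for b x
    using h that by (simp add: numeral_2_eq_2)
  have cp: "continuous_on ?B (partial c (partial b h))" if "b \<in> Basis" "c \<in> Basis" for b c
  proof (rule continuous_on_subset[OF _ subset_UNIV])
    show "continuous_on UNIV (partial c (partial b h))" using h that by (simp add: numeral_2_eq_2)
  qed
  have expand: "frechet_derivative g (at x) w = (\<Sum>b\<in>Basis. (w \<bullet> b) * partial b g x)"
    if "g differentiable (at x)" for g :: "'a \<Rightarrow> real" and x w
  proof -
    have "linear (frechet_derivative g (at x))" using that by (rule linear_frechet_derivative)
    then have "frechet_derivative g (at x) (\<Sum>b\<in>Basis. (w \<bullet> b) *\<^sub>R b) =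
        (\<Sum>b\<in>Basis. (w \<bullet> b) *\<^sub>R frechet_derivative g (at x) b)"
      by (simp add: linear_sum linear_scale)
    then show ?thesis by (simp add: euclidean_representation partial_def)
  qed
  have "\<forall>b\<in>Basis. \<forall>c\<in>Basis. \<exists>K. \<forall>x\<in>?B. \<bar>partial c (partial b h) x\<bar> \<le> K"
  proof (intro ballI)
    fix b c :: 'a assume "b \<in> Basis" "c \<in> Basis"
    then have "bounded (partial c (partial b h) ` ?B)"
      by (intro compact_imp_bounded compact_continuous_image cp compact_cball)
    then show "\<exists>K. \<forall>x\<in>?B. \<bar>partial c (partial b h) x\<bar> \<le> K" by (auto simp: bounded_iff)
  qed
  then obtain K2 where K2: "\<And>b c x. b \<in> Basis \<Longrightarrow> c \<in> Basis \<Longrightarrow> x \<in> ?B \<Longrightarrow> \<bar>partial c (partial b h) x\<bar> \<le> K2 b c"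
    by metis
  have cont1: "continuous_on ?B (partial b h)" if "b \<in> Basis" for b
    using dp[OF that] by (intro continuous_at_imp_continuous_on) (auto intro: differentiable_imp_continuous_within)
  have "\<forall>b\<in>Basis. \<exists>K. \<forall>x\<in>?B. \<bar>partial b h x\<bar> \<le> K"
  proof
    fix b :: 'a assume "b \<in> Basis"
    then have "bounded (partial b h ` ?B)"
      by (intro compact_imp_bounded compact_continuous_image cont1 compact_cball)
    then show "\<exists>K. \<forall>x\<in>?B. \<bar>partial b h x\<bar> \<le> K" by (auto simp: bounded_iff)
  qed
  then obtain K1 where K1: "\<And>b x. b \<in> Basis \<Longrightarrow> x \<in> ?B \<Longrightarrow> \<bar>partial b h x\<bar> \<le> K1 b"
    by metis
  define L1 where "L1 = (\<Sum>b\<in>(Basis::'a set). \<bar>K1 b\<bar>)"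
  define M where "M b = (\<Sum>c\<in>(Basis::'a set). \<bar>K2 b c\<bar>)" for b
  define L2 where "L2 = (\<Sum>b\<in>(Basis::'a set). M b)"
  have L: "0 \<le> L1" "0 \<le> L2" "\<And>b. 0 \<le> M b" by (auto simp: L1_def L2_def M_def intro!: sum_nonneg)
  have sum_bound: "\<bar>\<Sum>b\<in>Basis. (w \<bullet> b) * k b\<bar> \<le> (\<Sum>b\<in>Basis. \<bar>m b\<bar>) * norm w"
    if "\<And>b. b \<in> Basis \<Longrightarrow> \<bar>k b\<bar> \<le> \<bar>m b\<bar>" for w :: 'a and k m :: "'a \<Rightarrow> real"
  proof -
    have "\<bar>\<Sum>b\<in>Basis. (w \<bullet> b) * k b\<bar> \<le> (\<Sum>b\<in>Basis. \<bar>(w \<bullet> b) * k b\<bar>)" by (rule sum_abs)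
    also have "\<dots> \<le> (\<Sum>b\<in>Basis. norm w * \<bar>m b\<bar>)"
      unfolding abs_mult using that by (intro sum_mono mult_mono) (auto simp: Basis_le_norm)
    finally show ?thesis by (simp add: sum_distrib_left mult.commute)
  qed
  have first: "\<bar>frechet_derivative h (at a) w\<bar> \<le> L1 * norm w" if "a \<in> ?B" for a w
    unfolding expand[OF dh] L1_def
    by (rule sum_bound) (rule order_trans[OF K1[OF _ that] abs_ge_self])
  have lip: "\<bar>partial b h c - partial b h a\<bar> \<le> M b * norm (c - a)"
    if b: "b \<in> Basis" and ac: "a \<in> ?B" "c \<in> ?B" for a b c
  proof -
    have "norm (partial b h c - partial b h a) \<le> M b * norm (c - a)"
    proof (rule differentiable_bound[of ?B _ "\<lambda>x. frechet_derivative (partial b h) (at x)"])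
      fix x assume x: "x \<in> ?B"
      show "(partial b h has_derivative frechet_derivative (partial b h) (at x)) (at x within ?B)"
        using dp[OF b, of x] by (auto simp: frechet_derivative_works intro: has_derivative_at_withinI)
      show "onorm (frechet_derivative (partial b h) (at x)) \<le> M b"
      proof (rule onorm_le)
        fix w
        have "\<bar>frechet_derivative (partial b h) (at x) w\<bar> \<le> M b * norm w"
          unfolding expand[OF dp[OF b]] M_def
          by (rule sum_bound) (rule order_trans[OF K2[OF b _ x] abs_ge_self])
        then show "norm (frechet_derivative (partial b h) (at x) w) \<le> M b * norm w" by simp
      qed
    qed (use ac in auto)
    then show ?thesis by simp
  qed
  have second: "\<bar>h c - h a - frechet_derivative h (at a) (c - a)\<bar> \<le> L2 * (norm (c - a))\<^sup>2"
    if ac: "a \<in> ?B" "c \<in> ?B" for a c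
  proof -
    define g where "g x = h x - frechet_derivative h (at a) x" for x
    have lin: "linear (frechet_derivative h (at a))" using dh by (rule linear_frechet_derivative)
    have seg: "x \<in> ?B" "norm (x - a) \<le> norm (c - a)" if "x \<in> closed_segment a c" for x
    proof -
      show "x \<in> ?B" using that ac closed_segment_subset[OF _ _ convex_cball] by blast
      show "norm (x - a) \<le> norm (c - a)" using segment_bound1[of x a c] that by (simp add: norm_minus_commute)
    qed
    have "norm (g c - g a) \<le> L2 * norm (c - a) * norm (c - a)"
    proof (rule differentiable_bound[of "closed_segment a c" _
          "\<lambda>x w. frechet_derivative h (at x) w - frechet_derivative h (at a) w"])
      fix x assume x: "x \<in> closed_segment a c"
      have "(frechet_derivative h (at a) has_derivative frechet_derivative h (at a)) (at x within closed_segment a c)"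
        using lin by (simp add: linear_imp_has_derivative)
      moreover have "(h has_derivative frechet_derivative h (at x)) (at x within closed_segment a c)"
        using dh[of x] by (auto simp: frechet_derivative_works intro: has_derivative_at_withinI)
      ultimately show "(g has_derivative (\<lambda>w. frechet_derivative h (at x) w - frechet_derivative h (at a) w))
          (at x within closed_segment a c)"
        unfolding g_def[abs_def] by (intro has_derivative_diff)
      show "onorm (\<lambda>w. frechet_derivative h (at x) w - frechet_derivative h (at a) w) \<le> L2 * norm (c - a)"
      proof (rule onorm_le)
        fix w
        have "\<bar>\<Sum>b\<in>Basis. (w \<bullet> b) * (partial b h x - partial b h a)\<bar>
            \<le> (\<Sum>b\<in>Basis. \<bar>M b * norm (c - a)\<bar>) * norm w"
        proof (rule sum_bound)
          fix b :: 'a assume b: "b \<in> Basis"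
          have "\<bar>partial b h x - partial b h a\<bar> \<le> M b * norm (x - a)" using lip[OF b ac(1) seg(1)[OF x]] .
          also have "\<dots> \<le> M b * norm (c - a)" using seg(2)[OF x] L by (intro mult_left_mono)
          finally show "\<bar>partial b h x - partial b h a\<bar> \<le> \<bar>M b * norm (c - a)\<bar>" by simp
        qed
        also have "(\<Sum>b\<in>Basis. \<bar>M b * norm (c - a)\<bar>) = L2 * norm (c - a)"
          using L by (simp add: L2_def abs_mult sum_distrib_right)
        finally show "norm (frechet_derivative h (at x) w - frechet_derivative h (at a) w) \<le> L2 * norm (c - a) * norm w"
          unfolding expand[OF dh] by (simp add: right_diff_distrib sum_subtractf)
      qed
    qed auto
    moreover have "g c - g a = h c - h a - frechet_derivative h (at a) (c - a)"
      using linear_diff[OF lin, of c a] by (simp add: g_def)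
    ultimately show ?thesis by (simp add: power2_eq_square mult.assoc)
  qed
  show ?thesis
  proof (intro exI[of _ "max L1 L2"] conjI ballI allI)
    fix a w :: 'a assume a: "a \<in> ?B"
    have "L1 * norm w \<le> max L1 L2 * norm w" by (intro mult_right_mono) auto
    then show "\<bar>frechet_derivative h (at a) w\<bar> \<le> max L1 L2 * norm w"
      using first[OF a, of w] by linarith
  next
    fix a c assume ac: "a \<in> ?B" "c \<in> ?B"
    have "L2 * (norm (c - a))\<^sup>2 \<le> max L1 L2 * (norm (c - a))\<^sup>2" by (intro mult_right_mono) auto
    then show "\<bar>h c - h a - frechet_derivative h (at a) (c - a)\<bar> \<le> max L1 L2 * (norm (c - a))\<^sup>2"
      using second[OF ac] by linarith
  qed (use L in auto)
qed

lemma infdist_frontier_le: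
  fixes x y :: "'a::real_normed_vector"
  assumes "x \<in> S" "y \<notin> S"
  shows "infdist x (frontier S) \<le> dist x y"
proof -
  have "closed_segment x y \<inter> frontier S \<noteq> {}"
    using assms by (intro connected_Int_frontier) auto
  then obtain w where w: "w \<in> closed_segment x y" "w \<in> frontier S" by blast
  have "infdist x (frontier S) \<le> dist x w" using w(2) by (rule infdist_le)
  also have "\<dots> \<le> dist x y"
    using segment_bound1[OF w(1)] by (simp add: dist_norm norm_minus_commute)
  finally show ?thesis .
qed

text \<open>In the chart, \<open>\<Omega>\<close> is the set where $g(x) = x \cdot v - h(Px)$ is positive. For \<open>x0\<close> near \<open>z\<close> let
  $G = \nabla g(x_0)$. By the quadratic Taylor bound, $g$ is positive wherever
  $g(x_0) + G \cdot (x - x_0) > |x - x_0|^2 / (2\mu)$ with $\mu$ small, and this set is exactly the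
  ball with centre $y = x_0 + \mu G$ and $R^2 = \mu^2 |G|^2 + 2 \mu g(x_0)$. Hence
  $R^2 - |x_0 - y|^2 = 2 \mu g(x_0)$. Moreover $x_0 - g(x_0) v$ has $g = 0$, so that $g(x_0)$
  bounds the distance to the boundary.\<close>

lemma interior_balls_near_boundary_point:
  fixes \<Omega> :: "'a::euclidean_space set"
  assumes z: "z \<notin> \<Omega>" and \<rho>0: "0 < \<rho>0" and v: "norm v = 1" and h: "Ck_on 2 UNIV h"
    and chart: "\<Omega> \<inter> ball z \<rho>0 = {x \<in> ball z \<rho>0. h (x - (x \<bullet> v) *\<^sub>R v) < x \<bullet> v}"
  shows "\<exists>\<epsilon>>0. \<exists>\<rho>>0. \<exists>c>0. \<forall>x0\<in>\<Omega> \<inter> ball z \<epsilon>. \<exists>y R. \<rho> \<le> R \<and> ball y R \<subseteq> \<Omega> \<and>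
      c * infdist x0 (frontier \<Omega>) \<le> R\<^sup>2 - (norm (x0 - y))\<^sup>2"
proof -
  define P where "P x = x - (x \<bullet> v) *\<^sub>R v" for x
  define g where "g x = x \<bullet> v - h (P x)" for x
  have P_diff: "P x - P y = P (x - y)" for x y by (simp add: P_def algebra_simps)
  have vv: "v \<bullet> v = 1" using v by (simp add: norm_eq_1)
  have P_norm: "norm (P w) \<le> norm w" for w
  proof -
    have "(norm (P w))\<^sup>2 = (norm w)\<^sup>2 - (w \<bullet> v)\<^sup>2"
      unfolding power2_norm_eq_inner P_def
      by (simp add: algebra_simps inner_commute vv power2_eq_square)
    then have "(norm (P w))\<^sup>2 \<le> (norm w)\<^sup>2" by simp
    then show ?thesis by (rule power2_le_imp_le) simp
  qed
  have P_ball: "P x \<in> cball (P z) \<rho>0" if "x \<in> ball z \<rho>0" for x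
    using that P_norm[of "z - x"] by (simp add: dist_norm P_diff)
  obtain L where L: "0 \<le> L"
    and L1: "\<And>a w. a \<in> cball (P z) \<rho>0 \<Longrightarrow> \<bar>frechet_derivative h (at a) w\<bar> \<le> L * norm w"
    and L2: "\<And>a c. a \<in> cball (P z) \<rho>0 \<Longrightarrow> c \<in> cball (P z) \<rho>0 \<Longrightarrow>
        \<bar>h c - h a - frechet_derivative h (at a) (c - a)\<bar> \<le> L * (norm (c - a))\<^sup>2"
    using Ck_on_2_taylor_bound[OF h, of "P z" \<rho>0] by blast
  have dh: "h differentiable (at x)" for x using h by (simp add: numeral_2_eq_2)
  have inside: "x \<in> \<Omega> \<longleftrightarrow> 0 < g x" if "x \<in> ball z \<rho>0" for x
  proof -
    have "x \<in> \<Omega> \<inter> ball z \<rho>0 \<longleftrightarrow> h (x - (x \<bullet> v) *\<^sub>R v) < x \<bullet> v"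
      unfolding chart using that by simp
    then show ?thesis using that by (simp add: g_def P_def)
  qed
  have lower: "g a + ((x - a) \<bullet> v - frechet_derivative h (at (P a)) (P (x - a))) - L * (norm (x - a))\<^sup>2 \<le> g x"
    if "a \<in> ball z \<rho>0" "x \<in> ball z \<rho>0" for a x
  proof -
    have "L * (norm (P (x - a)))\<^sup>2 \<le> L * (norm (x - a))\<^sup>2"
      using L P_norm by (intro mult_left_mono power_mono) auto
    then show ?thesis
      using L2[OF P_ball[OF that(1)] P_ball[OF that(2)]] unfolding P_diff g_def inner_diff_left
      by linarith
  qed
  have upper: "g x \<le> (1 + 2 * L) * norm (x - z)" if "x \<in> ball z \<rho>0" "norm (x - z) \<le> 1" for x
  proof -
    have zb: "z \<in> ball z \<rho>0" using \<rho>0 by simp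
    have "g z \<le> 0" using inside[OF zb] z by simp
    moreover have "(x - z) \<bullet> v \<le> norm (x - z)" using norm_cauchy_schwarz[of "x - z" v] v by simp
    moreover have "\<bar>frechet_derivative h (at (P z)) (P (x - z))\<bar> \<le> L * norm (x - z)"
      using order_trans[OF L1[OF P_ball[OF zb]] mult_left_mono[OF P_norm L]] .
    moreover have "L * (norm (P (x - z)))\<^sup>2 \<le> L * (norm (x - z) * 1)"
      unfolding power2_eq_square using that L P_norm[of "x - z"]
      by (intro mult_left_mono mult_mono) auto
    ultimately show ?thesis
      using L2[OF P_ball[OF zb] P_ball[OF that(1)]] unfolding P_diff g_def
      by (simp add: algebra_simps)
  qed
  define \<Gamma> where "\<Gamma> = 1 + L"
  define \<mu> where "\<mu> = min (1 / (2 * \<Gamma>)) (\<rho>0 / (4 * (\<Gamma> + 2)))"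
  define \<epsilon> where "\<epsilon> = min (min 1 (\<rho>0 / 4)) (\<mu> / (1 + 2 * L))"
  have \<Gamma>: "1 \<le> \<Gamma>" using L by (simp add: \<Gamma>_def)
  have \<mu>: "0 < \<mu>" using \<Gamma> \<rho>0 by (simp add: \<mu>_def)
  have \<mu>L: "\<mu> * L \<le> 1 / 2"
  proof -
    have "\<mu> * L \<le> 1 / (2 * \<Gamma>) * \<Gamma>" using L \<Gamma> by (intro mult_mono) (auto simp: \<mu>_def \<Gamma>_def)
    then show ?thesis using \<Gamma> by simp
  qed
  have \<mu>\<rho>: "\<mu> * (\<Gamma> + 2) \<le> \<rho>0 / 4"
  proof -
    have "\<mu> * (\<Gamma> + 2) \<le> \<rho>0 / (4 * (\<Gamma> + 2)) * (\<Gamma> + 2)"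
      using \<Gamma> by (intro mult_right_mono) (auto simp: \<mu>_def)
    also have "\<dots> = \<rho>0 / 4" using \<Gamma> by (simp add: field_simps)
    finally show ?thesis .
  qed
  have \<epsilon>: "0 < \<epsilon>" "\<epsilon> \<le> 1" "\<epsilon> \<le> \<rho>0 / 4" "(1 + 2 * L) * \<epsilon> \<le> \<mu>"
  proof -
    show "0 < \<epsilon>" using \<rho>0 \<mu> L by (simp add: \<epsilon>_def)
    show "\<epsilon> \<le> 1" "\<epsilon> \<le> \<rho>0 / 4" unfolding \<epsilon>_def by linarith+
    have "(1 + 2 * L) * \<epsilon> \<le> (1 + 2 * L) * (\<mu> / (1 + 2 * L))"
      using L by (intro mult_left_mono) (auto simp: \<epsilon>_def)
    then show "(1 + 2 * L) * \<epsilon> \<le> \<mu>" using L by simp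
  qed
  have "\<exists>y R. \<mu> \<le> R \<and> ball y R \<subseteq> \<Omega> \<and> 2 * \<mu> * infdist x0 (frontier \<Omega>) \<le> R\<^sup>2 - (norm (x0 - y))\<^sup>2"
    if x0: "x0 \<in> \<Omega> \<inter> ball z \<epsilon>" for x0
  proof -
    have near: "norm (x0 - z) < \<epsilon>" using x0 by (simp add: dist_norm norm_minus_commute)
    have x0b: "x0 \<in> ball z \<rho>0" using x0 \<epsilon>(3) \<rho>0 by simp
    define g0 where "g0 = g x0"
    have g0: "0 < g0" using inside[OF x0b] x0 by (simp add: g0_def)
    have g0_le: "g0 \<le> \<mu>"
    proof -
      have "g0 \<le> (1 + 2 * L) * norm (x0 - z)" unfolding g0_def using near \<epsilon> by (intro upper x0b) auto
      also have "\<dots> \<le> (1 + 2 * L) * \<epsilon>" using near L by (intro mult_left_mono) auto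
      finally show ?thesis using \<epsilon> by simp
    qed
    define D where "D w = w \<bullet> v - frechet_derivative h (at (P x0)) (P w)" for w
    have lin: "linear (frechet_derivative h (at (P x0)))" using dh by (rule linear_frechet_derivative)
    have "linear D"
    proof (rule linearI)
      have P_add: "P (a + c) = P a + P c" and P_scale: "P (k *\<^sub>R a) = k *\<^sub>R P a" for a c k
        by (simp_all add: P_def algebra_simps)
      show "D (a + c) = D a + D c" for a c
        by (simp add: D_def P_add linear_add[OF lin] inner_add_left)
      show "D (k *\<^sub>R a) = k *\<^sub>R D a" for k a
        by (simp add: D_def P_scale linear_scale[OF lin] right_diff_distrib)
    qed
    \<comment> \<open>The gradient of \<open>g\<close> at \<open>x0\<close>.\<close>
    define G where "G = (\<Sum>b\<in>Basis. D b *\<^sub>R b)"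
    have G: "G \<bullet> w = D w" for w
    proof -
      have "D w = D (\<Sum>b\<in>Basis. (w \<bullet> b) *\<^sub>R b)" by (simp add: euclidean_representation)
      also have "\<dots> = (\<Sum>b\<in>Basis. (w \<bullet> b) * D b)"
        using \<open>linear D\<close> by (simp add: linear_sum linear_scale)
      also have "\<dots> = G \<bullet> w"
        unfolding G_def inner_sum_left inner_scaleR_left by (simp add: inner_commute mult.commute)
      finally show ?thesis by simp
    qed
    have "P v = 0" by (simp add: P_def vv)
    then have "G \<bullet> v = 1" by (simp add: G D_def vv linear_0[OF lin])
    then have G_ge: "1 \<le> norm G" using norm_cauchy_schwarz[of G v] v by simp
    have G_le: "norm G \<le> \<Gamma>"
    proof -
      have "norm G * norm G = D G" using G[of G] by (simp add: power2_norm_eq_inner flip: power2_eq_square)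
      also have "\<dots> \<le> norm G + L * norm G"
        using norm_cauchy_schwarz[of G v] v
          order_trans[OF L1[OF P_ball[OF x0b]] mult_left_mono[OF P_norm L], of G]
        unfolding D_def by simp
      also have "\<dots> = \<Gamma> * norm G" by (simp add: \<Gamma>_def algebra_simps)
      finally show ?thesis by (rule mult_right_le_imp_le) (use G_ge in linarith)
    qed
    define y where "y = x0 + \<mu> *\<^sub>R G"
    define R where "R = sqrt (\<mu>\<^sup>2 * (norm G)\<^sup>2 + 2 * \<mu> * g0)"
    have R2: "R\<^sup>2 = \<mu>\<^sup>2 * (norm G)\<^sup>2 + 2 * \<mu> * g0" using \<mu> g0 by (simp add: R_def)
    have "0 \<le> R" using \<mu> g0 by (simp add: R_def)
    have yx0: "norm (x0 - y) = \<mu> * norm G" using \<mu> by (simp add: y_def)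
    have R_ge: "\<mu> * norm G \<le> R"
    proof (rule power2_le_imp_le)
      show "(\<mu> * norm G)\<^sup>2 \<le> R\<^sup>2" using \<mu> g0 by (simp add: R2 power_mult_distrib)
    qed fact
    have "\<mu> * 1 \<le> \<mu> * norm G" using \<mu> G_ge by (intro mult_left_mono) auto
    then have "\<mu> \<le> R" using R_ge by simp
    have R_le: "R \<le> \<rho>0 / 4"
    proof -
      have "R\<^sup>2 \<le> \<mu>\<^sup>2 * \<Gamma>\<^sup>2 + 2 * \<mu> * \<mu>"
        unfolding R2 using G_le g0_le \<mu> by (intro add_mono mult_left_mono power_mono) auto
      also have "\<dots> = \<mu>\<^sup>2 * (\<Gamma>\<^sup>2 + 2)" by (simp add: power2_eq_square distrib_left)
      also have "\<dots> \<le> \<mu>\<^sup>2 * (\<Gamma> + 2)\<^sup>2"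
        using \<Gamma> by (intro mult_left_mono) (simp_all add: power2_sum)
      also have "\<dots> = (\<mu> * (\<Gamma> + 2))\<^sup>2" by (simp add: power_mult_distrib)
      finally have "R \<le> \<mu> * (\<Gamma> + 2)"
        by (rule power2_le_imp_le) (use \<mu> \<Gamma> in simp)
      then show ?thesis using \<mu>\<rho> by simp
    qed
    have "ball y R \<subseteq> \<Omega>"
    proof
      fix x assume x: "x \<in> ball y R"
      have xy: "norm (x - y) < R" using x by (simp add: dist_norm norm_minus_commute)
      have "norm (x - z) \<le> norm (x - y) + norm (x0 - y) + norm (x0 - z)"
        using norm_triangle_ineq[of "x - y" "y - z"] norm_triangle_ineq[of "y - x0" "x0 - z"]
        by (simp add: norm_minus_commute)
      then have "norm (x - z) < \<rho>0" using xy yx0 R_ge R_le near \<epsilon>(3) \<rho>0 by linarith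
      then have xb: "x \<in> ball z \<rho>0" by (simp add: dist_norm norm_minus_commute)
      define w where "w = x - x0"
      have xy_eq: "x - y = w - \<mu> *\<^sub>R G" by (simp add: w_def y_def)
      have "(norm (x - y))\<^sup>2 = (norm w)\<^sup>2 - 2 * \<mu> * (G \<bullet> w) + \<mu>\<^sup>2 * (norm G)\<^sup>2"
        unfolding xy_eq power2_norm_eq_inner by (simp add: algebra_simps inner_commute power2_eq_square)
      moreover have "(norm (x - y))\<^sup>2 < R\<^sup>2" using xy by (intro power_strict_mono) auto
      ultimately have "(norm w)\<^sup>2 < 2 * \<mu> * (G \<bullet> w + g0)" by (simp add: R2 algebra_simps)
      moreover have "2 * \<mu> * (L * (norm w)\<^sup>2) \<le> (norm w)\<^sup>2"
        using mult_right_mono[OF \<mu>L, of "2 * (norm w)\<^sup>2"] by (simp add: mult_ac)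
      ultimately have "2 * \<mu> * (L * (norm w)\<^sup>2) < 2 * \<mu> * (G \<bullet> w + g0)" by linarith
      then have "L * (norm w)\<^sup>2 < G \<bullet> w + g0" using \<mu> by simp
      then have "0 < g x" using lower[OF x0b xb] by (simp add: G D_def g0_def w_def)
      then show "x \<in> \<Omega>" using inside[OF xb] by simp
    qed
    moreover have "infdist x0 (frontier \<Omega>) \<le> g0"
    proof -
      define x1 where "x1 = x0 - g0 *\<^sub>R v"
      have "norm (x1 - z) \<le> norm (x0 - z) + g0"
        using norm_triangle_ineq4[of "x0 - z" "g0 *\<^sub>R v"] v g0 by (simp add: x1_def algebra_simps)
      moreover have "\<mu> * 1 \<le> \<mu> * (\<Gamma> + 2)" using \<mu> \<Gamma> by (intro mult_left_mono) auto
      ultimately have "norm (x1 - z) < \<rho>0" using g0_le near \<epsilon>(3) \<rho>0 \<mu>\<rho> by linarith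
      then have x1: "x1 \<in> ball z \<rho>0" by (simp add: dist_norm norm_minus_commute)
      have "P x1 = P x0" by (simp add: x1_def P_def algebra_simps vv)
      moreover have "x1 \<bullet> v = x0 \<bullet> v - g0" by (simp add: x1_def inner_diff_left vv)
      ultimately have "g x1 = 0" unfolding g_def g0_def by simp
      then have "x1 \<notin> \<Omega>" using inside[OF x1] by simp
      then have "infdist x0 (frontier \<Omega>) \<le> dist x0 x1" using x0 by (intro infdist_frontier_le) auto
      then show ?thesis using g0 v by (simp add: x1_def dist_norm)
    qed
    then have "2 * \<mu> * infdist x0 (frontier \<Omega>) \<le> R\<^sup>2 - (norm (x0 - y))\<^sup>2"
      using \<mu> by (simp add: R2 yx0 power_mult_distrib)
    ultimately show ?thesis using \<open>\<mu> \<le> R\<close> by blast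
  qed
  then show ?thesis using \<epsilon>(1) \<mu> by (intro exI[of _ \<epsilon>] exI[of _ \<mu>] exI[of _ "2 * \<mu>"] conjI) auto
qed

text \<open>An interior ball condition in the form in which it is used: every point lies in a ball of radius at
  least \<open>\<rho>\<close> inside \<open>\<Omega>\<close>, at a depth proportional to its distance to the boundary. The local versions
  are combined by compactness of the closure.\<close>

lemma uniform_interior_balls:
  fixes \<Omega> :: "'a::euclidean_space set"
  assumes \<Omega>: "smooth_bounded_domain \<Omega>"
  shows "\<exists>\<rho>>0. \<exists>c>0. \<forall>x0\<in>\<Omega>. \<exists>y R. \<rho> \<le> R \<and> ball y R \<subseteq> \<Omega> \<and>
      c * infdist x0 (frontier \<Omega>) \<le> R\<^sup>2 - (norm (x0 - y))\<^sup>2"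
proof -
  have op: "open \<Omega>" and bd: "bounded \<Omega>" and smooth: "smooth_boundary \<Omega>"
    using \<Omega> by (auto simp: smooth_bounded_domain_def)
  obtain B where B: "0 < B" "\<And>x. x \<in> closure \<Omega> \<Longrightarrow> norm x \<le> B"
    using bounded_closure[OF bd] by (auto simp: bounded_pos)
  have dist_le: "infdist x (frontier \<Omega>) \<le> 2 * B" if "x \<in> \<Omega>" for x
  proof (cases "frontier \<Omega> = {}")
    case True then show ?thesis using B by (simp add: infdist_def)
  next
    case False
    then obtain w where w: "w \<in> frontier \<Omega>" by blast
    have "infdist x (frontier \<Omega>) \<le> dist x w" using w by (rule infdist_le)
    also have "\<dots> \<le> norm x + norm w" unfolding dist_norm by (rule norm_triangle_ineq4)
    also have "\<dots> \<le> 2 * B"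
      using B(2)[of x] B(2)[of w] w that closure_subset[of \<Omega>] by (auto simp: frontier_def)
    finally show ?thesis .
  qed
  define Q where "Q \<rho> c x0 \<longleftrightarrow> (\<exists>y R. \<rho> \<le> R \<and> ball y R \<subseteq> \<Omega> \<and>
      c * infdist x0 (frontier \<Omega>) \<le> R\<^sup>2 - (norm (x0 - y))\<^sup>2)" for \<rho> c x0
  have Q_mono: "Q \<rho>' c' x0" if "Q \<rho> c x0" "\<rho>' \<le> \<rho>" "c' \<le> c" for \<rho> c \<rho>' c' x0
    using that mult_right_mono[OF that(3) infdist_nonneg[of x0 "frontier \<Omega>"]]
    unfolding Q_def by (meson order_trans)
  have "\<forall>z\<in>closure \<Omega>. \<exists>e. 0 < fst e \<and> 0 < fst (snd e) \<and> 0 < snd (snd e) \<and>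
      (\<forall>x0\<in>\<Omega> \<inter> ball z (fst e). Q (fst (snd e)) (snd (snd e)) x0)"
  proof
    fix z assume z: "z \<in> closure \<Omega>"
    have "\<exists>\<epsilon>>0. \<exists>\<rho>>0. \<exists>c>0. \<forall>x0\<in>\<Omega> \<inter> ball z \<epsilon>. Q \<rho> c x0"
    proof (cases "z \<in> \<Omega>")
      case True
      then obtain d where d: "0 < d" "ball z d \<subseteq> \<Omega>" using op by (auto simp: open_contains_ball)
      have "Q (d / 2) ((d / 2)\<^sup>2 / (2 * B)) x0" if x0: "x0 \<in> \<Omega> \<inter> ball z (d / 2)" for x0
        unfolding Q_def
      proof (intro exI[of _ x0] exI[of _ "d / 2"] conjI)
        show "ball x0 (d / 2) \<subseteq> \<Omega>"
        proof
          fix x assume "x \<in> ball x0 (d / 2)"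
          then have "x \<in> ball z d" using x0 dist_triangle[of z x x0] by simp
          then show "x \<in> \<Omega>" using d by blast
        qed
        have "(d / 2)\<^sup>2 / (2 * B) * infdist x0 (frontier \<Omega>) \<le> (d / 2)\<^sup>2 / (2 * B) * (2 * B)"
          using B x0 by (intro mult_left_mono dist_le) auto
        then show "(d / 2)\<^sup>2 / (2 * B) * infdist x0 (frontier \<Omega>) \<le> (d / 2)\<^sup>2 - (norm (x0 - x0))\<^sup>2"
          using B by simp
      qed simp
      then show ?thesis using d B
        by (intro exI[of _ "d / 2"] exI[of _ "(d / 2)\<^sup>2 / (2 * B)"] conjI) auto
    next
      case False
      then have "z \<in> frontier \<Omega>" using z op by (simp add: frontier_def interior_open)
      then obtain \<rho>0 v h where "0 < \<rho>0" "norm v = 1" "\<forall>k. Ck_on k UNIV h"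
        "\<Omega> \<inter> ball z \<rho>0 = {x \<in> ball z \<rho>0. h (x - (x \<bullet> v) *\<^sub>R v) < x \<bullet> v}"
        using smooth unfolding smooth_boundary_def by meson
      then show ?thesis
        using interior_balls_near_boundary_point[OF False, of \<rho>0 v h] unfolding Q_def by simp
    qed
    then show "\<exists>e. 0 < fst e \<and> 0 < fst (snd e) \<and> 0 < snd (snd e) \<and>
        (\<forall>x0\<in>\<Omega> \<inter> ball z (fst e). Q (fst (snd e)) (snd (snd e)) x0)" by force
  qed
  then obtain e where e: "\<And>z. z \<in> closure \<Omega> \<Longrightarrow> 0 < fst (e z) \<and> 0 < fst (snd (e z)) \<and> 0 < snd (snd (e z)) \<and>
      (\<forall>x0\<in>\<Omega> \<inter> ball z (fst (e z)). Q (fst (snd (e z))) (snd (snd (e z))) x0)"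
    by metis
  have "compact (closure \<Omega>)" using bd by (simp add: compact_closure)
  moreover have "closure \<Omega> \<subseteq> (\<Union>z\<in>closure \<Omega>. ball z (fst (e z)))" using e by force
  ultimately obtain N where N: "N \<subseteq> closure \<Omega>" "finite N" "closure \<Omega> \<subseteq> (\<Union>z\<in>N. ball z (fst (e z)))"
    using compactE_image[of "closure \<Omega>" "closure \<Omega>" "\<lambda>z. ball z (fst (e z))"] open_ball by metis
  define \<rho> where "\<rho> = Min (insert 1 ((\<lambda>z. fst (snd (e z))) ` N))"
  define c where "c = Min (insert 1 ((\<lambda>z. snd (snd (e z))) ` N))"
  have pos: "0 < \<rho>" "0 < c" using N e by (auto simp: \<rho>_def c_def)
  have "Q \<rho> c x0" if "x0 \<in> \<Omega>" for x0
  proof -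
    have "x0 \<in> (\<Union>z\<in>N. ball z (fst (e z)))" using that N(3) closure_subset[of \<Omega>] by (meson subsetD)
    then obtain z where z: "z \<in> N" "x0 \<in> ball z (fst (e z))" by (elim UN_E)
    have "\<rho> \<le> fst (snd (e z))" "c \<le> snd (snd (e z))"
      unfolding \<rho>_def c_def using N(2) z(1) by (auto intro!: Min_le)
    then show ?thesis using Q_mono e[of z] z N(1) that by blast
  qed
  then show ?thesis using pos unfolding Q_def by blast
qed

section \<open>Type I bounds and touchdown\<close>

text \<open>By continuity an essential bound on an open set is a pointwise bound.\<close>

lemma Linf_norm_le_imp_bound:
  fixes f :: "'a::euclidean_space \<Rightarrow> real"
  assumes "open \<Omega>" and f: "continuous_on \<Omega> f" and norm: "Linf_norm \<Omega> f \<le> ereal M" and x: "x \<in> \<Omega>"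
  shows "f x \<le> M"
proof -
  let ?C = "{y \<in> \<Omega>. f y \<le> M}"
  have "AE y in lebesgue_on \<Omega>. ereal \<bar>f y\<bar> \<le> Linf_norm \<Omega> f"
    unfolding Linf_norm_def by (rule esssup_AE)
  then have "AE y in lebesgue_on \<Omega>. f y \<le> M"
  proof (rule AE_mp, intro AE_I2 impI)
    fix y assume "ereal \<bar>f y\<bar> \<le> Linf_norm \<Omega> f"
    then have "ereal \<bar>f y\<bar> \<le> ereal M" using norm by (rule order_trans)
    then show "f y \<le> M" by simp
  qed
  moreover have "\<Omega> \<in> sets lebesgue" using \<open>open \<Omega>\<close> by simp
  ultimately have "AE y\<in>\<Omega> in lebesgue. f y \<le> M"
    by (simp add: AE_restrict_space_iff)
  then have "AE y\<in>\<Omega> in lebesgue. y \<in> closure ?C"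
    by (rule AE_mp) (use closure_subset[of ?C] in \<open>auto intro!: AE_I2\<close>)
  then have "x \<in> closure ?C"
    using mem_closed_if_AE_lebesgue_open[OF \<open>open \<Omega>\<close> closed_closure] x by blast
  then obtain X where X: "\<And>n. X n \<in> ?C" "X \<longlonglongrightarrow> x" unfolding closure_sequential by blast
  have "(\<lambda>n. f (X n)) \<longlonglongrightarrow> f x"
    using f x X unfolding continuous_on_sequentially by (auto simp: o_def)
  then show ?thesis by (rule LIMSEQ_le_const2) (use X in auto)
qed

lemma holder_profile_continuous:
  assumes "f \<in> holder_profiles \<Omega>"
  shows "continuous_on (closure \<Omega>) f"
proof -
  obtain \<alpha> C where \<alpha>: "0 < \<alpha>"
    and C: "\<And>x y. x \<in> closure \<Omega> \<Longrightarrow> y \<in> closure \<Omega> \<Longrightarrow> \<bar>f x - f y\<bar> \<le> C * dist x y powr \<alpha>"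
    using assms unfolding holder_profiles_def by blast
  show ?thesis
    unfolding continuous_on_def
  proof
    fix x assume x: "x \<in> closure \<Omega>"
    have "((\<lambda>y. C * dist y x powr \<alpha>) \<longlongrightarrow> C * dist x x powr \<alpha>) (at x within closure \<Omega>)"
      by (intro tendsto_intros tendsto_powr') (use \<alpha> in auto)
    then have "((\<lambda>y. C * dist y x powr \<alpha>) \<longlongrightarrow> 0) (at x within closure \<Omega>)" by simp
    moreover have "\<forall>\<^sub>F y in at x within closure \<Omega>. norm (f y - f x) \<le> C * dist y x powr \<alpha>"
      using C x by (auto simp: eventually_at_filter intro!: always_eventually)
    ultimately have "((\<lambda>y. f y - f x) \<longlongrightarrow> 0) (at x within closure \<Omega>)"
      by (rule Lim_null_comparison[rotated])
    then show "(f \<longlongrightarrow> f x) (at x within closure \<Omega>)" by (simp add: LIM_zero_iff)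
  qed
qed

context membrane
begin

text \<open>A lower bound of type I excludes touchdown at points where \<open>f\<close> is small. Write
  $\tau = T' - t$ and $A = A_0^{p+1}$, so that $v = 1-u \ge A_0 \tau^{1/(p+1)}$ near \<open>x0\<close> and hence
  $v_t - \Delta v \ge -F A_0^{-p} \tau^{-p/(p+1)}$ with some $F > f$. Since $(p+1) F < A$, there is
  $\kappa < A_0$ with $\kappa/(p+1) > F A_0^{-p}$, and then
  $\kappa \tau^{1/(p+1)} + \epsilon (1 - |x-x_0|^2 / r^2)$ is a subsolution below $v$ for small
  $\epsilon$. It stays positive at \<open>x0\<close> as $\tau \to 0$. The radius \<open>r\<close> depends on the modulus of
  continuity of \<open>f\<close>, but the condition on $f(x_0)$ does not.\<close>

lemma no_touchdown_if_small_profile: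
  assumes T: "T = ereal T'" and x0: "x0 \<in> \<Omega>" and f: "continuous_on \<Omega> f"
    and b: "0 < b" "ball x0 b \<subseteq> \<Omega>" and t0: "0 \<le> t0" "t0 < T'" and A: "0 < A"
    and type_I: "\<And>t x. t0 \<le> t \<Longrightarrow> t < T' \<Longrightarrow> x \<in> ball x0 b \<Longrightarrow> A * (T' - t) \<le> (1 - u t x) powr (p + 1)"
    and small: "f x0 < A / (p + 1)"
  shows "x0 \<notin> touchdown_set \<Omega> T u"
proof
  assume td: "x0 \<in> touchdown_set \<Omega> T u"
  have p1: "0 < p + 1" "p + 1 \<noteq> 0" using p_pos by auto
  obtain F where F: "f x0 < F" "F < A / (p + 1)" using small dense by blast
  have "0 \<le> f x0" using f_nonneg x0 closure_subset by blast
  then have "0 < F" using F by simp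
  have "\<forall>\<^sub>F x in at x0. f x < F"
    using f x0 open_domain F(1) by (metis continuous_on_eq_continuous_at isCont_def order_tendstoD(2))
  then obtain d where d: "0 < d" "\<And>x. x \<noteq> x0 \<Longrightarrow> dist x x0 < d \<Longrightarrow> f x < F"
    unfolding eventually_at by blast
  define r where "r = min b d / 2"
  have r: "0 < r" "r < b" "r < d" using b d by (auto simp: r_def)
  have f_less: "f x < F" if "x \<in> ball x0 r" for x
    using d(2)[of x] F that r by (cases "x = x0") (auto simp: dist_commute)
  have r_sub: "cball x0 r \<subseteq> ball x0 b" "cball x0 r \<subseteq> \<Omega>" using r b by auto
  define A0 where "A0 = A powr (1 / (p + 1))"
  have A0: "0 < A0" "A0 powr (p + 1) = A" using A p1 by (auto simp: A0_def powr_powr)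
  have A0_split: "A0 powr (- p) * A = A0"
    unfolding A0(2)[symmetric] powr_add[symmetric] using A0(1) by simp
  have v_lower: "A0 * (T' - t) powr (1 / (p + 1)) \<le> 1 - u t x"
    if "t0 \<le> t" "t < T'" "x \<in> ball x0 b" for t x
  proof -
    have "(A * (T' - t)) powr (1 / (p + 1)) \<le> ((1 - u t x) powr (p + 1)) powr (1 / (p + 1))"
      using type_I[OF that] A that p1 by (intro powr_mono2) auto
    moreover have "x \<in> closure \<Omega>" using that(3) b(2) closure_subset[of \<Omega>] by blast
    then have "0 < 1 - u t x" using u_less_one[of t x] that t0 by (simp add: T)
    ultimately show ?thesis using p1 A that by (simp add: powr_mult powr_powr A0_def)
  qed
  define \<kappa> where "\<kappa> = ((p + 1) * F * A0 powr (- p) + A0) / 2"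
  have "(p + 1) * F * A0 powr (- p) < A0"
  proof -
    have "(p + 1) * F < A" using F p1 by (simp add: pos_less_divide_eq mult.commute)
    then have "(p + 1) * F * A0 powr (- p) < A * A0 powr (- p)"
      using A0 by (intro mult_strict_right_mono) auto
    then show ?thesis using A0_split by (simp add: mult.commute)
  qed
  moreover have "(a + A0) / 2 < A0 \<and> a < (a + A0) / 2" if "a < A0" for a using that by simp
  ultimately have \<kappa>: "\<kappa> < A0" "(p + 1) * F * A0 powr (- p) < \<kappa>" unfolding \<kappa>_def by blast+
  have "0 < (p + 1) * F * A0 powr (- p)" using \<open>0 < F\<close> p1 A0 by simp
  then have \<kappa>_pos: "0 < \<kappa>" using \<kappa>(2) by linarith
  define m where "m = \<kappa> / (p + 1) - F * A0 powr (- p)"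
  have m: "0 < m" using \<kappa>(2) p1 by (simp add: m_def pos_less_divide_eq mult_ac)
  define \<tau>0 where "\<tau>0 = T' - t0"
  have \<tau>0: "0 < \<tau>0" using t0 by (simp add: \<tau>0_def)
  define \<epsilon> where "\<epsilon> = min ((A0 - \<kappa>) * \<tau>0 powr (1 / (p + 1))) (m * \<tau>0 powr (- p / (p + 1)) * r\<^sup>2 / (2 * DIM('a))) / 2"
  have \<epsilon>: "0 < \<epsilon>" "\<epsilon> < (A0 - \<kappa>) * \<tau>0 powr (1 / (p + 1))"
    "2 * DIM('a) * \<epsilon> / r\<^sup>2 < m * \<tau>0 powr (- p / (p + 1))"
  proof -
    have *: "0 < (A0 - \<kappa>) * \<tau>0 powr (1 / (p + 1))" "0 < m * \<tau>0 powr (- p / (p + 1)) * r\<^sup>2 / (2 * DIM('a))"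
      using \<kappa> \<tau>0 m r by auto
    have half_min: "0 < min a b / 2 \<and> min a b / 2 < a \<and> min a b / 2 < b" if "0 < a" "0 < b" for a b :: real
      using that by (simp add: min_def)
    from half_min[OF *] show "0 < \<epsilon>" "\<epsilon> < (A0 - \<kappa>) * \<tau>0 powr (1 / (p + 1))"
      unfolding \<epsilon>_def by blast+
    have "\<epsilon> < m * \<tau>0 powr (- p / (p + 1)) * r\<^sup>2 / (2 * DIM('a))"
      using half_min[OF *] unfolding \<epsilon>_def by blast
    then show "2 * DIM('a) * \<epsilon> / r\<^sup>2 < m * \<tau>0 powr (- p / (p + 1))"
      using r by (simp add: pos_less_divide_eq pos_divide_less_eq mult_ac)
  qed
  define w where "w t x = (\<kappa> * (T' - t) powr (1 / (p + 1)) + \<epsilon>) + (- (\<epsilon> / r\<^sup>2)) * (norm (x - x0))\<^sup>2" for t x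
  have above: "w t x < 1 - u t x" if t: "t0 \<le> t" "t < T'" and x: "x \<in> cball x0 r" for t x
  proof -
    define W where "W t x = 1 + (- 1) * u t x + (- 1) * w t x" for t x
    have closed_ball: "closure (ball x0 r) = cball x0 r" using r by simp
    have before: "ereal s < T" if "s \<le> t" for s using that t by (simp add: T)
    have "0 < W t x"
    proof (rule parabolic_first_contact[where W=W and t=t and x=x and U="ball x0 r" and ?t0.0=t0 and ?t1.0=t])
      have "continuous_on ({t0..t} \<times> closure (ball x0 r)) (\<lambda>(t, x). u t x)"
        unfolding closed_ball using r_sub closure_subset[of \<Omega>] t0 before[of t]
        by (intro continuous_u_on) auto
      moreover have "continuous_on ({t0..t} \<times> closure (ball x0 r)) (\<lambda>z. (T' - fst z) powr (1 / (p + 1)))"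
        using t p1 by (intro continuous_on_powr continuous_intros) auto
      ultimately show "continuous_on ({t0..t} \<times> closure (ball x0 r)) (\<lambda>(t, x). W t x)"
        unfolding W_def w_def case_prod_beta
        by (intro continuous_on_add continuous_on_mult continuous_on_const continuous_on_power
            continuous_on_norm continuous_on_diff continuous_on_snd continuous_on_id)
      show "0 < W t0 y" if "y \<in> closure (ball x0 r)" for y
      proof -
        have "A0 * \<tau>0 powr (1 / (p + 1)) \<le> 1 - u t0 y"
          using v_lower[of t0 y] that r_sub t0 unfolding closed_ball \<tau>0_def by blast
        moreover have "w t0 y \<le> \<kappa> * \<tau>0 powr (1 / (p + 1)) + \<epsilon>"
          using \<epsilon>(1) by (simp add: w_def \<tau>0_def)
        ultimately show ?thesis using \<epsilon>(2) by (simp add: W_def left_diff_distrib)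
      qed
      show "0 < W s y" if s: "t0 \<le> s" "s \<le> t" and y: "y \<in> frontier (ball x0 r)" for s y
      proof -
        have "norm (y - x0) = r" using y r by (simp add: frontier_ball dist_norm norm_minus_commute)
        then have "w s y = \<kappa> * (T' - s) powr (1 / (p + 1))" using r by (simp add: w_def)
        also have "\<dots> < A0 * (T' - s) powr (1 / (p + 1))"
          using \<kappa> s t by (intro mult_strict_right_mono) auto
        also have "\<dots> \<le> 1 - u s y"
          using s t y r_sub by (intro v_lower) (auto simp: frontier_def closed_ball)
        finally show ?thesis by (simp add: W_def)
      qed
      fix s y assume s: "t0 < s" "s \<le> t" and y: "y \<in> ball x0 r" and 0: "W s y = 0"
        and nonneg: "\<And>s' y. t0 \<le> s' \<Longrightarrow> s' \<le> s \<Longrightarrow> y \<in> closure (ball x0 r) \<Longrightarrow> 0 \<le> W s' y"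
      let ?\<tau> = "T' - s"
      have \<tau>: "0 < ?\<tau>" "?\<tau> \<le> \<tau>0" using s t by (auto simp: \<tau>0_def)
      have y': "y \<in> \<Omega>" "y \<in> ball x0 b" using y r_sub ball_subset_cball by blast+
      have expo: "1 / (p + 1) - 1 = - p / (p + 1)" using p1 by (simp add: field_simps)
      have "((\<lambda>s. \<kappa> * (T' - s) powr (1 / (p + 1)) + \<epsilon>) has_real_derivative
          \<kappa> * (1 / (p + 1) * ?\<tau> powr (- p / (p + 1)) * (- 1))) (at s)"
        using \<tau> unfolding expo[symmetric]
        by (auto intro!: derivative_eq_intros simp: powr_diff)
      then have "has_heat_op w s y (\<kappa> * (1 / (p + 1) * ?\<tau> powr (- p / (p + 1)) * (- 1)) + 0 * (norm (y - x0))\<^sup>2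
          - (- (\<epsilon> / r\<^sup>2)) * (2 * DIM('a) * (1::real) + 4 * (norm (y - x0))\<^sup>2 * 0))"
        unfolding w_def[abs_def]
        by (intro has_heat_op_radial[where E="\<lambda>\<sigma>. \<sigma>" and E'="\<lambda>_. 1" and b="\<lambda>_. - (\<epsilon> / r\<^sup>2)"]) auto
      moreover have "has_heat_op u s y (f y * (1 - u s y) powr (- p))"
        using s t0 before[of s] y' by (intro heat_op_u) auto
      moreover have "has_heat_op (\<lambda>_ _. 1) s y 0" by (rule has_heat_op_time) simp
      ultimately have "has_heat_op W s y (0 + (- 1) * (f y * (1 - u s y) powr (- p))
          + (- 1) * (\<kappa> * (1 / (p + 1) * ?\<tau> powr (- p / (p + 1)) * (- 1)) + 0 * (norm (y - x0))\<^sup>2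
          - (- (\<epsilon> / r\<^sup>2)) * (2 * DIM('a) * (1::real) + 4 * (norm (y - x0))\<^sup>2 * 0)))"
        unfolding W_def[abs_def] by (intro has_heat_op_add has_heat_op_cmult)
      from heat_op_at_contact[OF this s(1) open_ball y 0]
      have "0 + (- 1) * (f y * (1 - u s y) powr (- p))
          + (- 1) * (\<kappa> * (1 / (p + 1) * ?\<tau> powr (- p / (p + 1)) * (- 1)) + 0 * (norm (y - x0))\<^sup>2
          - (- (\<epsilon> / r\<^sup>2)) * (2 * DIM('a) * (1::real) + 4 * (norm (y - x0))\<^sup>2 * 0)) \<le> 0"
        using nonneg closure_subset[of "ball x0 r"] by blast
      then have "\<kappa> / (p + 1) * ?\<tau> powr (- p / (p + 1)) \<le>
          f y * (1 - u s y) powr (- p) + 2 * DIM('a) * \<epsilon> / r\<^sup>2"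
        by (simp add: algebra_simps)
      also have "f y * (1 - u s y) powr (- p) \<le> F * (A0 powr (- p) * ?\<tau> powr (- p / (p + 1)))"
      proof (rule mult_mono)
        have "(1 - u s y) powr (- p) \<le> (A0 * ?\<tau> powr (1 / (p + 1))) powr (- p)"
          using v_lower[of s y] s t y' A0 \<tau> p_pos by (intro powr_mono2') auto
        also have "\<dots> = A0 powr (- p) * ?\<tau> powr (- p / (p + 1))"
          using A0 \<tau> by (simp add: powr_mult powr_powr)
        finally show "(1 - u s y) powr (- p) \<le> A0 powr (- p) * ?\<tau> powr (- p / (p + 1))" .
      qed (use f_less[OF y] \<open>0 < F\<close> in auto)
      finally have "m * ?\<tau> powr (- p / (p + 1)) \<le> 2 * DIM('a) * \<epsilon> / r\<^sup>2"
        by (simp add: m_def left_diff_distrib mult.assoc)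
      moreover have "m * \<tau>0 powr (- p / (p + 1)) \<le> m * ?\<tau> powr (- p / (p + 1))"
        using m \<tau> p_pos by (intro mult_left_mono powr_mono2') (auto simp: divide_nonpos_pos)
      ultimately show False using \<epsilon>(3) by linarith
    qed (use t x r in auto)
    then show ?thesis by (simp add: W_def)
  qed
  obtain ti xi where seq: "\<And>i. 0 < ti i" "\<And>i. ereal (ti i) < T" "xi \<longlonglongrightarrow> x0"
    "(\<lambda>i. ereal (ti i)) \<longlonglongrightarrow> T" "(\<lambda>i. u (ti i) (xi i)) \<longlonglongrightarrow> 1"
    using td unfolding touchdown_set_def by blast
  have "ti \<longlonglongrightarrow> T'" using seq(4) by (simp add: T)
  then have "\<forall>\<^sub>F i in sequentially. t0 < ti i" using t0 by (intro order_tendstoD)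
  moreover have "\<forall>\<^sub>F i in sequentially. dist (xi i) x0 < r / 2" using seq(3) r by (intro tendstoD) auto
  moreover have "\<forall>\<^sub>F i in sequentially. 1 - \<epsilon> * (3 / 4) < u (ti i) (xi i)"
    using seq(5) \<epsilon> by (intro order_tendstoD) auto
  ultimately have "\<forall>\<^sub>F i in sequentially. False"
  proof eventually_elim
    case (elim i)
    have i: "ti i < T'" using seq(2)[of i] by (simp add: T)
    have "w (ti i) (xi i) < 1 - u (ti i) (xi i)"
      using elim i r by (intro above) (simp_all add: dist_commute)
    moreover have "(norm (xi i - x0))\<^sup>2 \<le> (r / 2)\<^sup>2"
      using elim by (intro power_mono) (auto simp: dist_norm)
    then have "\<epsilon> / r\<^sup>2 * (norm (xi i - x0))\<^sup>2 \<le> \<epsilon> / r\<^sup>2 * (r / 2)\<^sup>2" using \<epsilon> by (intro mult_left_mono) auto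
    then have "\<epsilon> / r\<^sup>2 * (norm (xi i - x0))\<^sup>2 \<le> \<epsilon> / 4" using r by (simp add: power_divide)
    moreover have "0 \<le> \<kappa> * (T' - ti i) powr (1 / (p + 1))" using \<kappa>_pos by simp
    ultimately show ?case using elim unfolding w_def by (simp only: minus_mult_left[symmetric])
  qed
  then show False by simp
qed

text \<open>At time $0$ the function $1-u$ equals $1$, so the gain over the lag \<open>s\<close> is at least $u(s,x)$, which is
  bounded below by a multiple of \<open>s\<close> where \<open>f\<close> is at least \<open>r\<close>.\<close>

lemma gain_initial:
  fixes r s M :: real
  assumes r: "0 < r" "ball c r \<subseteq> \<Omega>" "\<And>x. x \<in> ball c r \<Longrightarrow> r \<le> f x"
    and s: "0 \<le> s" "s \<le> M" "ereal s < T" and x: "x \<in> ball c (r / 2)"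
  shows "r / (r\<^sup>2 + 2 * DIM('a) * M) * s * (3 / 4 * r\<^sup>2) \<le> gain p u s 0 x"
proof -
  define e where "e = r / (r\<^sup>2 + 2 * DIM('a) * M)"
  have M: "0 \<le> M" using s by simp
  have den: "0 < r\<^sup>2 + 2 * DIM('a) * M" using r M by (intro add_pos_nonneg) auto
  have e: "0 \<le> e" "e * (r\<^sup>2 + 2 * DIM('a) * s) \<le> r"
  proof -
    show "0 \<le> e" using r den by (simp add: e_def)
    then have "e * (r\<^sup>2 + 2 * DIM('a) * s) \<le> e * (r\<^sup>2 + 2 * DIM('a) * M)"
      using s by (intro mult_left_mono) auto
    then show "e * (r\<^sup>2 + 2 * DIM('a) * s) \<le> r" using den by (simp add: e_def)
  qed
  have xr: "x \<in> ball c r" "norm (x - c) \<le> r / 2"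
    using x r by (auto simp: dist_norm norm_minus_commute)
  then have x': "x \<in> closure \<Omega>" using r closure_subset[of \<Omega>] by blast
  have "e * s * (3 / 4 * r\<^sup>2) \<le> e * s * (r\<^sup>2 - (norm (x - c))\<^sup>2)"
  proof (rule mult_left_mono)
    have "(norm (x - c))\<^sup>2 \<le> (r / 2)\<^sup>2" using xr by (intro power_mono) auto
    then show "3 / 4 * r\<^sup>2 \<le> r\<^sup>2 - (norm (x - c))\<^sup>2" by (simp add: power_divide)
  qed (use e s in simp)
  also have "\<dots> \<le> u s x" using u_lower_bound_initial[OF r e s(1,3) xr(1)] .
  also have "u s x \<le> gain p u s 0 x"
  proof -
    have u: "0 \<le> u s x" "u s x < 1" using u_nonneg u_less_one s x' by auto
    then have "(1 - u s x) powr (p + 1) \<le> (1 - u s x) powr 1"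
      using p_pos by (intro powr_mono') auto
    then show ?thesis using u u_initial[OF x'] by (simp add: gain_def)
  qed
  finally show ?thesis by (simp add: e_def)
qed

text \<open>Before that time the solution stays below $1/2$. This guarantees a time interval of fixed length
  in which the gain can spread.\<close>

lemma touchdown_time_lower_bound:
  assumes F: "0 < F" "\<And>x. x \<in> \<Omega> \<Longrightarrow> f x \<le> F" and x0: "x0 \<in> touchdown_set \<Omega> T u" and T: "T = ereal T'"
  shows "1 / (4 * F * 2 powr (p + 1)) \<le> T'"
proof (rule ccontr)
  assume short: "\<not> ?thesis"
  obtain ti xi where seq: "\<And>i. 0 < ti i" "\<And>i. ereal (ti i) < T" "\<And>i. xi i \<in> \<Omega>"
    "(\<lambda>i. u (ti i) (xi i)) \<longlonglongrightarrow> 1"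
    using x0 unfolding touchdown_set_def by blast
  have "u (ti i) (xi i) \<le> 1 / 2" for i
  proof -
    have "ti i < T'" using seq(2)[of i] by (simp add: T)
    then show ?thesis
      using seq(1-3)[of i] short closure_subset[of \<Omega>]
      by (intro less_imp_le u_upper_bound_initial[OF F]) auto
  qed
  then have "1 \<le> (1 / 2 :: real)" by (intro LIMSEQ_le_const2[OF seq(4)]) auto
  then show False by simp
qed

end

theorem theorem1p1:
  fixes \<Omega> :: "'a::euclidean_space set" and p M r :: real
  assumes "p > 0" and "smooth_bounded_domain \<Omega>" and "M > 0" and "r > 0"
  shows "\<exists>\<gamma>0>0. \<forall>f\<in>holder_profiles \<Omega>. \<forall>T u.
    maximal_classical_solution p \<Omega> f T u \<longrightarrow>
    T \<le> ereal M \<longrightarrow>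
    Linf_norm \<Omega> f \<le> ereal M \<longrightarrow>
    (\<exists>c. ball c r \<subseteq> \<Omega> \<and> (\<forall>x\<in>closure \<Omega>. f x \<ge> r * indicator (ball c r) x)) \<longrightarrow>
    (\<forall>x0\<in>\<Omega>. f x0 < \<gamma>0 * infdist x0 (frontier \<Omega>) powr (p + 1) \<longrightarrow>
       x0 \<notin> touchdown_set \<Omega> T u)"
proof -
  have \<Omega>: "open \<Omega>" "connected \<Omega>" "bounded \<Omega>"
    using assms(2) by (auto simp: smooth_bounded_domain_def)
  have p1: "0 < p + 1" using assms by simp
  obtain B where B: "\<And>x. x \<in> \<Omega> \<Longrightarrow> norm x \<le> B" using \<Omega>(3) by (auto simp: bounded_iff)
  obtain \<rho> d where \<rho>: "0 < \<rho>" and d: "0 < d"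
    and balls: "\<And>x0. x0 \<in> \<Omega> \<Longrightarrow> \<exists>y R. \<rho> \<le> R \<and> ball y R \<subseteq> \<Omega> \<and>
      d * infdist x0 (frontier \<Omega>) \<le> R\<^sup>2 - (norm (x0 - y))\<^sup>2"
    using uniform_interior_balls[OF assms(2)] by blast
  define \<rho>1 where "\<rho>1 = min r \<rho>"
  have \<rho>1: "0 < \<rho>1" "\<rho>1 \<le> r" "\<rho>1 \<le> \<rho>" using assms \<rho> by (auto simp: \<rho>1_def)
  \<comment> \<open>A lower bound for touchdown times; each of the two spreading stages uses at least \<open>Tmin/4\<close>.\<close>
  define Tmin where "Tmin = 1 / (4 * M * 2 powr (p + 1))"
  have Tmin: "0 < Tmin" using assms by (simp add: Tmin_def)
  obtain \<theta> where \<theta>: "0 < \<theta>"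
    and interior: "\<And>a b. ball a \<rho>1 \<subseteq> \<Omega> \<Longrightarrow> ball b \<rho>1 \<subseteq> \<Omega> \<Longrightarrow>
      spreads_by \<theta> (Tmin / 4) M p \<Omega> (ball a (\<rho>1 / 2)) (ball b (\<rho>1 / 2))"
    using spreads_uniformly[OF assms(1) \<Omega> \<rho>1(1), of "Tmin / 4" M] Tmin by auto
  obtain \<theta>' where \<theta>': "0 < \<theta>'"
    and boundary: "\<And>(\<Omega> :: 'a set) f T u y R s t0 \<tau> k. membrane p \<Omega> f T u \<Longrightarrow>
      \<rho>1 / 2 \<le> R \<and> R \<le> B \<and> ball y R \<subseteq> \<Omega> \<Longrightarrow>
      0 \<le> s \<and> 0 \<le> t0 \<and> Tmin / 4 \<le> \<tau> \<and> \<tau> \<le> M \<and> ereal (t0 + \<tau> + s) < T \<Longrightarrow> 0 \<le> k \<Longrightarrow>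
      (\<forall>x\<in>ball y (\<rho>1 / 2). k powr (p + 1) \<le> gain p u s t0 x) \<Longrightarrow>
      (\<forall>x\<in>ball y R. (\<theta>' * k * (R\<^sup>2 - (norm (x - y))\<^sup>2)) powr (p + 1) \<le> gain p u s (t0 + \<tau>) x)"
    using gain_spreads_from_ball[of "\<rho>1 / 2" "Tmin / 4" p B M, where 'a='a] \<rho>1 Tmin by auto
  define e where "e = r / (r\<^sup>2 + 2 * DIM('a) * M) * (3 / 4 * r\<^sup>2)"
  have e: "0 < e" using assms by (auto simp: e_def intro!: divide_pos_pos mult_pos_pos add_pos_pos)
  define \<gamma>0 where "\<gamma>0 = e * (\<theta>' * \<theta> * (d / 2)) powr (p + 1) / (p + 1)"
  have \<gamma>0: "0 < \<gamma>0" using e \<theta> \<theta>' d p1 by (simp add: \<gamma>0_def)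
  have "x0 \<notin> touchdown_set \<Omega> T u"
    if f: "f \<in> holder_profiles \<Omega>" and sol: "maximal_classical_solution p \<Omega> f T u"
      and TM: "T \<le> ereal M" and fM: "Linf_norm \<Omega> f \<le> ereal M"
      and c: "ball c r \<subseteq> \<Omega>" "\<forall>x\<in>closure \<Omega>. f x \<ge> r * indicator (ball c r) x"
      and x0: "x0 \<in> \<Omega>" and small: "f x0 < \<gamma>0 * infdist x0 (frontier \<Omega>) powr (p + 1)"
    for f T u c x0
  proof
    assume td: "x0 \<in> touchdown_set \<Omega> T u"
    have f_cont: "continuous_on \<Omega> f"
      using holder_profile_continuous[OF f] closure_subset by (rule continuous_on_subset)
    have f_le: "f x \<le> M" if "x \<in> \<Omega>" for x
      using Linf_norm_le_imp_bound[OF \<Omega>(1) f_cont fM that] .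
    interpret membrane p \<Omega> f T u
    proof
      show "0 < p" "open \<Omega>" "bounded \<Omega>" by fact+
      show "0 \<le> f x" if "x \<in> closure \<Omega>" for x using f that unfolding holder_profiles_def by blast
      show "\<exists>F. \<forall>x\<in>\<Omega>. f x \<le> F" using f_le by blast
      show "classical_solution p \<Omega> f T u" using sol unfolding maximal_classical_solution_def by blast
    qed
    obtain T' where T: "T = ereal T'" using TM existence_time_pos by (cases T) auto
    have T'M: "T' \<le> M" using TM by (simp add: T)
    have T'min: "Tmin \<le> T'"
      unfolding Tmin_def using touchdown_time_lower_bound[OF assms(3) f_le td T] .
    have f_ball: "r \<le> f x" if "x \<in> ball c r" for x
    proof -
      have "x \<in> closure \<Omega>" using c(1) that closure_subset by blast
      then have "r * indicator (ball c r) x \<le> f x" using c(2) by blast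
      then show ?thesis using that by (simp only: indicator_simps mult_1_right)
    qed
    define \<delta> where "\<delta> = infdist x0 (frontier \<Omega>)"
    have "0 \<le> f x0" using f_nonneg x0 closure_subset by blast
    then have "\<delta> \<noteq> 0" using small by (auto simp: \<delta>_def)
    then have \<delta>: "0 < \<delta>" using infdist_nonneg[of x0 "frontier \<Omega>"] by (simp add: \<delta>_def)
    obtain y R where R: "\<rho> \<le> R" "ball y R \<subseteq> \<Omega>" and x0R: "d * \<delta> \<le> R\<^sup>2 - (norm (x0 - y))\<^sup>2"
      using balls[OF x0] unfolding \<delta>_def by blast
    have "ball y R \<subseteq> cball 0 B" using R(2) B by (auto simp: subset_iff)
    then have "R \<le> B"
      using R(1) \<rho> zero_le_dist[of y 0] by (simp only: ball_subset_cball_iff) linarith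
    define q where "q x = R\<^sup>2 - (norm (x - y))\<^sup>2" for x
    have "continuous (at x0) q" unfolding q_def[abs_def] by (intro continuous_intros)
    moreover have "d * \<delta> / 2 < q x0" using x0R d \<delta> by (simp add: q_def) (smt (verit) mult_pos_pos)
    ultimately have "\<forall>\<^sub>F x in at x0. d * \<delta> / 2 < q x"
      unfolding isCont_def by (rule order_tendstoD(1))
    then obtain b where b: "0 < b" "\<And>x. x \<noteq> x0 \<Longrightarrow> dist x x0 < b \<Longrightarrow> d * \<delta> / 2 < q x"
      unfolding eventually_at by blast
    have q: "d * \<delta> / 2 \<le> q x" if "x \<in> ball x0 b" for x
      using b(2)[of x] that \<open>d * \<delta> / 2 < q x0\<close> by (cases "x = x0") (auto simp: dist_commute)
    have sub: "ball x0 b \<subseteq> ball y R"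
    proof
      fix x assume "x \<in> ball x0 b"
      then have "0 < q x" using q[of x] mult_pos_pos[OF d \<delta>] by linarith
      then have "(norm (x - y))\<^sup>2 < R\<^sup>2" by (simp add: q_def)
      then have "norm (x - y) < R" by (rule power2_less_imp_less) (use R(1) \<rho> in linarith)
      then show "x \<in> ball y R" by (simp add: dist_norm norm_minus_commute)
    qed
    define A where "A = e * (\<theta>' * \<theta> * (d * \<delta> / 2)) powr (p + 1)"
    have A: "0 < A" using e \<theta> \<theta>' d \<delta> by (simp add: A_def)
    have "x0 \<notin> touchdown_set \<Omega> T u"
    proof (rule no_touchdown_if_small_profile[OF T x0 f_cont b(1), where A=A and ?t0.0="Tmin / 2"])
      show "ball x0 b \<subseteq> \<Omega>" using sub R(2) by blast
      have split: "\<theta>' * \<theta> * (d * \<delta> / 2) = (\<theta>' * \<theta> * (d / 2)) * \<delta>" by simp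
      have "(\<theta>' * \<theta> * (d * \<delta> / 2)) powr (p + 1) = (\<theta>' * \<theta> * (d / 2)) powr (p + 1) * \<delta> powr (p + 1)"
        unfolding split by (rule powr_mult)
      then have "A / (p + 1) = \<gamma>0 * \<delta> powr (p + 1)" by (simp add: A_def \<gamma>0_def)
      then show "f x0 < A / (p + 1)" using small by (simp add: \<delta>_def)
      fix t x assume t: "Tmin / 2 \<le> t" "t < T'" and x: "x \<in> ball x0 b"
      have step: "A * s \<le> (1 - u t x) powr (p + 1)" if s: "0 < s" "s < T' - t" for s
      proof -
        \<comment> \<open>The amplitude for which the initial gain over the lag \<open>s\<close> is at least $k^{p+1}$ near \<open>c\<close>.\<close>
        define k where "k = (e * s) powr (1 / (p + 1))"
        have k: "0 \<le> k" "k powr (p + 1) = e * s" using e s p1 by (auto simp: k_def powr_powr)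
        have start: "k powr (p + 1) \<le> gain p u s 0 z" if "z \<in> ball c (\<rho>1 / 2)" for z
        proof -
          have "z \<in> ball c (r / 2)" using that \<rho>1 by simp
          moreover have "0 \<le> t" using t Tmin by simp
          ultimately show ?thesis
            using gain_initial[OF assms(4) c(1) f_ball, of s M z] s t T'M
            by (simp add: k e_def T mult_ac)
        qed
        have half: "Tmin / 4 \<le> t / 2" "t / 2 \<le> M" "0 \<le> t" using t T'M Tmin by auto
        have mid: "\<forall>z\<in>ball y (\<rho>1 / 2). (\<theta> * k) powr (p + 1) \<le> gain p u s (0 + t / 2) z"
        proof
          fix z assume z: "z \<in> ball y (\<rho>1 / 2)"
          have "spreads_by \<theta> (Tmin / 4) M p \<Omega> (ball c (\<rho>1 / 2)) (ball y (\<rho>1 / 2))"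
            using c(1) R \<rho>1 subset_ball[of \<rho>1 r c] subset_ball[of \<rho>1 R y] by (intro interior) auto
          from this[unfolded spreads_by_def, rule_format, OF membrane_axioms _ k(1) _ z, of s 0 "t / 2"]
          show "(\<theta> * k) powr (p + 1) \<le> gain p u s (0 + t / 2) z"
            using s t half start by (auto simp: T)
        qed
        have "(\<theta>' * (\<theta> * k) * q x) powr (p + 1) \<le> gain p u s (0 + t / 2 + t / 2) x"
          unfolding q_def
          by (rule boundary[OF membrane_axioms _ _ _ mid, rule_format])
            (use R \<rho>1 \<open>R \<le> B\<close> s t half \<theta> k sub x in \<open>auto simp: T\<close>)
        also have "\<dots> \<le> (1 - u t x) powr (p + 1)" by (simp add: gain_def)
        finally have end_bound: "(\<theta>' * (\<theta> * k) * q x) powr (p + 1) \<le> (1 - u t x) powr (p + 1)" .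
        have "A * s = (\<theta>' * \<theta> * (d * \<delta> / 2)) powr (p + 1) * k powr (p + 1)"
          by (simp add: A_def k(2))
        also have "\<dots> = (\<theta>' * (\<theta> * k) * (d * \<delta> / 2)) powr (p + 1)"
          using \<theta> \<theta>' d \<delta> k by (subst powr_mult[symmetric]) (auto simp: mult_ac)
        also have "\<dots> \<le> (\<theta>' * (\<theta> * k) * q x) powr (p + 1)"
          using \<theta> \<theta>' d \<delta> k p1 q[OF x] by (intro powr_mono2 mult_left_mono) auto
        finally show ?thesis using end_bound by simp
      qed
      \<comment> \<open>The gain bound for all lags \<open>s < T' - t\<close> gives the bound for the limiting lag.\<close>
      show "A * (T' - t) \<le> (1 - u t x) powr (p + 1)"
      proof (rule ccontr)
        assume neg: "\<not> ?thesis"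
        define V where "V = (1 - u t x) powr (p + 1)"
        have "V / A < T' - t" using neg A by (simp add: V_def pos_divide_less_eq mult.commute)
        then obtain s where s: "V / A < s" "s < T' - t" using dense by blast
        moreover have "0 \<le> V / A" using A by (simp add: V_def)
        ultimately have "0 < s" by linarith
        then have "A * s \<le> V" "V < A * s"
          using step[of s] s A by (auto simp: V_def pos_divide_less_eq mult.commute)
        then show False by simp
      qed
    qed (use Tmin T'min A in auto)
    then show False using td by simp
  qed
  then show ?thesis using \<gamma>0 by (intro exI[of _ \<gamma>0]) blast
qed

end
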